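(* Consider the trust-aware $K$-armed bandit model described in the context, and let $\pi$ be the policy-maker's policy produced by the trust-aware UCB algorithm described in the context. There exist positive constants $C_1,C_2$, independent of $H$ and $K$, such that for every $K\ge2$ and every horizon $H\ge2$, $$\sup\ \mathbb{E}[\mathsf{reg}_H(\pi)] \le C_1\sqrt{KH\log(H)}+C_2K^4\log^2(H),$$ where the supremum is over all trust-aware bandit instances with $K$ arms (all reward distributions with rewards in $[0,1]$, all trust sets $\mathcal{T}\subset[K]$ containing at least one optimal arm, and all own policies $\pi^{\mathsf{own}}$).
   Context: Trust-aware multi-armed bandit. There are $K$ arms. Rewards $(R_h(1),\dots,R_h(K))_{h\ge1}$ are i.i.d. random vectors over time with entries in $[0,1]$; $r(k)=\mathbb{E}[R_1(k)]$ and $r^\star=\max_{k} r(k)$. An instance also specifies a trust set $\mathcal{T}\subset[K]$ (unknown to the policy-maker) containing at least one arm $k$ with $r(k)=r^\star$, and an own policy $\pi^{\mathsf{own}}=(\pi^{\mathsf{own}}_h)_{h\ge1}$ of distributions on $[K]$ (unknown to the policy-maker). At each time $h$: the policy-maker recommends $a_h^{\mathsf{pm}}$; $\chi_h\sim\mathsf{Bern}(t_h)$ is drawn independently (conditionally on the past) and $a_h^{\mathsf{own}}\sim\pi_h^{\mathsf{own}}$; the implementer pulls $a_h^{\mathsf{ac}}=a_h^{\mathsf{pm}}$ if $\chi_h=1$, else $a_h^{\mathsf{ac}}=a_h^{\mathsf{own}}$, and receives $R_h(a_h^{\mathsf{ac}})$. Trust: $t_h=\alpha_h/(\alpha_h+\beta_h)$,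 $\alpha_1=\beta_1=1$, $\alpha_h=\alpha_{h-1}+\mathbb{1}\{a^{\mathsf{pm}}_{h-1}\in\mathcal{T}\}$, $\beta_h=\beta_{h-1}+\mathbb{1}\{a^{\mathsf{pm}}_{h-1}\notin\mathcal{T}\}$ for $h\ge2$. The policy-maker observes only $(a_i^{\mathsf{ac}},R_i(a_i^{\mathsf{ac}}),\chi_i)_{i<h}$ before choosing at time $h$. Regret: $\mathsf{reg}_H(\pi)=\sum_{h=1}^H(r^\star-r(a_h^{\mathsf{ac}}))$. Trust-aware UCB algorithm (input $K$, $H$). Set $\widehat{\mathcal{T}}=\varnothing$, $m=30K^3\log(H)$ (an integer number of steps) and $H_0=2mK$. Stage 1: for $h=1,\dots,H_0$, recommend $a_h^{\mathsf{pm}}=k:=\lceil h/(2m)\rceil$ and observe $a_h^{\mathsf{ac}},R_h(a_h^{\mathsf{ac}}),\chi_h$. When $h=2mk$, compute $Y_k^{(1)}=\frac1m\sum_{i=1}^m\chi_{2m(k-1)+i}$ and $Y_k^{(2)}=\frac1m\sum_{i=m+1}^{2m}\chi_{2m(k-1)+i}$. If $k=1$: add arm $1$ to $\widehat{\mathcal{T}}$ if $Y_1^{(1)}+Y_1^{(2)}\ge1/2$. If $k>1$: add arm $k$ to $\widehat{\mathcal{T}}$ if $Y_k^{(2)}-Y_k^{(1)}\ge\lambda_k(\widehat{\mathcal{T}})$, where (with $\widehat{\mathcal{T}}$ the current set) $\lambda_k(\widehat{\mathcal{T}})=1/(5k)$ if $|\widehat{\mathcal{T}}|=0$, $=-1/(5k)$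 if $|\widehat{\mathcal{T}}|=k-1$, and $=0$ otherwise. Stage 2: set $N^{\mathsf{ac}}_{H_0+1}(a)=1$ and $\mathsf{UCB}_{H_0+1}(a)=1$ for all $a$. For $h=H_0+1,\dots,H$: recommend $a_h^{\mathsf{pm}}\in\arg\max_{a\in\widehat{\mathcal{T}}}\mathsf{UCB}_h(a)$ with ties broken uniformly at random; observe $a_h^{\mathsf{ac}},R_h(a_h^{\mathsf{ac}}),\chi_h$; update the quantities for arm $a_h^{\mathsf{ac}}$ via $N^{\mathsf{ac}}_s(a)=1\vee\sum_{i=H_0+1}^{s-1}\mathbb{1}\{a_i^{\mathsf{ac}}=a\}$ and $\mathsf{UCB}_s(a)=1\wedge\Big\{\frac{1}{N^{\mathsf{ac}}_s(a)}\sum_{i=H_0+1}^{s-1}R_i(a)\mathbb{1}\{a_i^{\mathsf{ac}}=a\}+2\sqrt{\log(H)/N^{\mathsf{ac}}_s(a)}\Big\}$ for $s>H_0+1$. *)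

theory Defs
  imports "HOL-Probability.Probability"
begin

text \<open>Trust-aware multi-armed bandit and the trust-aware UCB algorithm.
  Arms are 1..K.  Time steps are 1,2,...  Observed history entries are
  (a_ac, R(a_ac), chi); full history entries are (a_pm, a_ac, R(a_ac), chi).\<close>

type_synonym obs = "nat \<times> real \<times> bool"
type_synonym hentry = "nat \<times> nat \<times> real \<times> bool"
text \<open>Per-step noise: (reward vector, uniform for chi, own action, uniform for tie-breaking).\<close>
type_synonym noise = "(nat \<Rightarrow> real) \<times> real \<times> nat \<times> real"

definition tam_m :: "nat \<Rightarrow> nat \<Rightarrow> nat" where
  "tam_m K H = nat \<lceil>30 * real K ^ 3 * ln (real H)\<rceil>"

definition tam_H0 :: "nat \<Rightarrow> nat \<Rightarrow> nat" where
  "tam_H0 K H = 2 * tam_m K H * K"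

definition chi_at :: "obs list \<Rightarrow> nat \<Rightarrow> real" where
  "chi_at os j = (if snd (snd (os ! (j - 1))) then 1 else 0)"

fun trust_hat :: "nat \<Rightarrow> nat \<Rightarrow> obs list \<Rightarrow> nat \<Rightarrow> nat set" where
  "trust_hat K H os 0 = {}"
| "trust_hat K H os (Suc k) =
     (let S = trust_hat K H os k; m = tam_m K H; kk = Suc k;
          Y1 = (\<Sum>i=1..m. chi_at os (2*m*k + i)) / real m;
          Y2 = (\<Sum>i=m+1..2*m. chi_at os (2*m*k + i)) / real m;
          lam = (if card S = 0 then 1 / (5 * real kk)
                 else if card S = kk - 1 then - 1 / (5 * real kk) else 0)
      in if kk = 1 then (if Y1 + Y2 \<ge> 1/2 then {1} else {})
         else (if Y2 - Y1 \<ge> lam then insert kk S else S))"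

definition ucb :: "nat \<Rightarrow> nat \<Rightarrow> obs list \<Rightarrow> nat \<Rightarrow> real" where
  "ucb K H os a =
     (let H0 = tam_H0 K H; s = length os + 1;
          cnt = card {i \<in> {H0+1..<s}. fst (os ! (i - 1)) = a};
          N = max 1 cnt;
          sm = (\<Sum>i\<in>{H0+1..<s}. if fst (os ! (i - 1)) = a then fst (snd (os ! (i - 1))) else 0)
      in if cnt = 0 then 1
         else min 1 (sm / real N + 2 * sqrt (ln (real H) / real N)))"

definition pick_unif :: "nat set \<Rightarrow> real \<Rightarrow> nat" where
  "pick_unif A u = sorted_list_of_set A ! min (card A - 1) (nat \<lfloor>u * real (card A)\<rfloor>)"

text \<open>Recommendation of trust-aware UCB at time length os + 1.
  Convention: if the estimated trust set is empty in Stage 2, the argmax is over all arms.\<close>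
definition alg_choice :: "nat \<Rightarrow> nat \<Rightarrow> obs list \<Rightarrow> real \<Rightarrow> nat" where
  "alg_choice K H os tb =
     (let h = length os + 1; m = tam_m K H; H0 = tam_H0 K H
      in if h \<le> H0 then nat \<lceil>real h / real (2 * m)\<rceil>
         else (let T = trust_hat K H os K;
                   C = (if T = {} then {1..K} else T);
                   A = {a \<in> C. \<forall>b\<in>C. ucb K H os b \<le> ucb K H os a}
               in pick_unif A tb))"

definition alpha_tr :: "nat set \<Rightarrow> hentry list \<Rightarrow> nat" where
  "alpha_tr T hs = 1 + length (filter (\<lambda>e. fst e \<in> T) hs)"

definition beta_tr :: "nat set \<Rightarrow> hentry list \<Rightarrow> nat" where
  "beta_tr T hs = 1 + length (filter (\<lambda>e. fst e \<notin> T) hs)"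

definition trust_level :: "nat set \<Rightarrow> hentry list \<Rightarrow> real" where
  "trust_level T hs = real (alpha_tr T hs) / real (alpha_tr T hs + beta_tr T hs)"

text \<open>One step of the interaction: chi = 1 iff u < t_h (u uniform on [0,1]), so chi ~ Bern(t_h).\<close>
definition next_entry :: "nat \<Rightarrow> nat \<Rightarrow> nat set \<Rightarrow> hentry list \<Rightarrow> noise \<Rightarrow> hentry" where
  "next_entry K H T hs \<xi> =
     (case \<xi> of (Rv, u, ao, tb) \<Rightarrow>
       (let p = alg_choice K H (map snd hs) tb;
            c = (u < trust_level T hs);
            a = (if c then p else ao)
        in (p, a, Rv a, c)))"

fun traj :: "nat \<Rightarrow> nat \<Rightarrow> nat set \<Rightarrow> (nat \<Rightarrow> noise) \<Rightarrow> nat \<Rightarrow> hentry list" where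
  "traj K H T \<omega> 0 = []"
| "traj K H T \<omega> (Suc n) = (let hs = traj K H T \<omega> n in hs @ [next_entry K H T hs (\<omega> (Suc n))])"

definition arm_mean :: "(nat \<Rightarrow> real) measure \<Rightarrow> nat \<Rightarrow> real" where
  "arm_mean D k = (\<integral>x. x k \<partial>D)"

definition opt_mean :: "(nat \<Rightarrow> real) measure \<Rightarrow> nat \<Rightarrow> real" where
  "opt_mean D K = Max (arm_mean D ` {1..K})"

definition regret :: "nat \<Rightarrow> nat \<Rightarrow> nat set \<Rightarrow> (nat \<Rightarrow> real) measure \<Rightarrow> (nat \<Rightarrow> noise) \<Rightarrow> real" where
  "regret K H T D \<omega> =
     (\<Sum>h=1..H. opt_mean D K - arm_mean D (fst (snd (traj K H T \<omega> H ! (h - 1)))))"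

definition noise_space :: "(nat \<Rightarrow> real) measure \<Rightarrow> (nat \<Rightarrow> nat pmf) \<Rightarrow> (nat \<Rightarrow> noise) measure" where
  "noise_space D own = PiM UNIV (\<lambda>h. D \<Otimes>\<^sub>M (uniform_measure lborel {0..1::real} \<Otimes>\<^sub>M
        (measure_pmf (own h) \<Otimes>\<^sub>M uniform_measure lborel {0..1::real})))"

definition expected_regret :: "nat \<Rightarrow> nat \<Rightarrow> nat set \<Rightarrow> (nat \<Rightarrow> real) measure \<Rightarrow> (nat \<Rightarrow> nat pmf) \<Rightarrow> real" where
  "expected_regret K H T D own = (\<integral>\<omega>. regret K H T D \<omega> \<partial>(noise_space D own))"

definition trust_aware_instance :: "nat \<Rightarrow> (nat \<Rightarrow> real) measure \<Rightarrow> nat set \<Rightarrow> (nat \<Rightarrow> nat pmf) \<Rightarrow> bool" where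
  "trust_aware_instance K D T own \<longleftrightarrow>
     prob_space D \<and> sets D = sets (PiM {1..K} (\<lambda>_. borel)) \<and>
     (AE x in D. \<forall>k\<in>{1..K}. 0 \<le> x k \<and> x k \<le> 1) \<and>
     T \<subseteq> {1..K} \<and> (\<exists>k\<in>T. arm_mean D k = opt_mean D K) \<and>
     (\<forall>h. set_pmf (own h) \<subseteq> {1..K})"

end

theory Submission
  imports Defs
begin

text \<open>
  In Stage 1 the recommendations are deterministic, so the trust levels are too and the trust draws
  are independent Bernoulli variables. While arm \<open>k\<close> is recommended, the probability that the draw
  disagrees with the trust status of \<open>k\<close> is \<open>B / (S + i)\<close>, which decreases in \<open>i\<close>; comparing the two
  halves of the block therefore reveals the status. The drift can be as small as \<open>1 / k\<^sup>2\<close>, but then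
  the variance is of order \<open>1 / k\<close>, and a Bernstein-type bound with \<open>m \<ge> 30 K\<^sup>3 log H\<close> samples
  gives an error probability of at most \<open>H powr (-5/8)\<close> per arm. This suffices because only horizons
  \<open>H \<ge> H0 \<ge> K ^ 4\<close> matter.

  Once the trust set is identified, Stage 2 recommends trusted arms only, so the recommendation at
  time \<open>h\<close> is refused with probability at most \<open>(1 + H0) / (h + 1)\<close>, which sums to \<open>O(K ^ 4 log\<^sup>2 H)\<close>.
  Followed recommendations obey the usual UCB analysis; concentration of the empirical means under
  adaptive sampling comes from the exponential supermartingale
  \<open>exp (l * (S - N * r) - N * l\<^sup>2 / 8)\<close>.
\<close>

section \<open>Exponential moments and adapted products\<close>

text \<open>Hoeffding's bound only sees the squared drift: an exponent of order
  \<open>m / k^4\<close>, hence \<open>K^4 log H\<close> samples per arm and a Stage 1 of length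
  \<open>K^5 log H\<close>. Keeping the variance \<open>z * (1 - z)\<close> of each draw repairs
  this: when few earlier arms have the opposite status, draws against the status of the current arm
  are rare, and their variance shrinks together with the drift. When no earlier arm has the opposite
  status, there is almost no drift to see; the shifted thresholds \<open>1 / (5 * k)\<close> of the
  algorithm then separate "almost no drift" from the drift of order \<open>1 / k\<close> which the
  other status would cause.

  The exponent 5/8 is what the final balance asks for: misidentification costs at most
  \<open>H * K * H powr (-5/8) = K * H powr (3/8)\<close>, and \<open>K <= H powr (1/4)\<close>
  turns this into \<open>sqrt (K * H)\<close>. For \<open>H < H0\<close> the trivial bound
  \<open>H\<close> is already of the order of Stage 1.

  All randomness is one product of per-step noises and the history is a function of it, so
  conditioning on the past becomes Fubini in a single coordinate.\<close>

lemma exp_le_quadratic: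
  fixes x :: real
  assumes "\<bar>x\<bar> \<le> 1/2"
  shows "exp x \<le> 1 + x + 2/3 * x\<^sup>2"
proof -
  obtain t where t: "\<bar>t\<bar> \<le> \<bar>x\<bar>" "exp x = (\<Sum>m<3. x^m / fact m) + exp t / fact 3 * x^3"
    using Maclaurin_exp_le by blast
  have "exp t \<le> exp (1/2)" using t assms by simp
  also have "\<dots> \<le> 2" using exp_bound[of "1/2"] by (simp add: power2_eq_square)
  finally have et: "exp t \<le> 2" .
  \<comment> \<open>The remainder is at most \<open>2/6 * \<bar>x\<bar>^3\<close>, hence at most
    \<open>x\<^sup>2 / 6\<close>; together with \<open>x\<^sup>2 / 2\<close> this is the constant
    2/3.\<close>
  have "exp t / fact 3 * x^3 \<le> exp t / fact 3 * \<bar>x\<bar>^3"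
    using abs_ge_self[of "x^3"] by (intro mult_left_mono) (auto simp: power_abs)
  also have "\<dots> \<le> 2 / fact 3 * \<bar>x\<bar>^3"
    using et by (intro mult_right_mono divide_right_mono) auto
  also have "\<dots> = 1/3 * (\<bar>x\<bar> * x\<^sup>2)"
    by (simp add: fact_numeral power3_eq_cube power2_eq_square)
  also have "\<dots> \<le> 1/3 * (1/2 * x\<^sup>2)"
    using assms by (intro mult_left_mono mult_right_mono) auto
  finally have "exp t / fact 3 * x^3 \<le> 1/6 * x\<^sup>2" by simp
  moreover have "(\<Sum>m<3. x^m / fact m) = 1 + x + x\<^sup>2 / 2"
    by (simp add: eval_nat_numeral)
  ultimately show ?thesis using t(2) by simp
qed

text \<open>Centring kills the linear term of the quadratic bound, so only the variance
  \<open>prob E * (1 - prob E)\<close> is left. This factor, absent from Hoeffding's lemma, is what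
  the block tests live on.\<close>

lemma (in prob_space) nn_integral_exp_bernoulli_le:
  assumes E: "E \<in> events" and w: "\<bar>w\<bar> \<le> 1/2"
  shows "(\<integral>\<^sup>+x. ennreal (exp (w * (indicator E x - prob E))) \<partial>M)
         \<le> ennreal (exp (2/3 * w\<^sup>2 * (prob E * (1 - prob E))))"
proof -
  define z where "z = prob E"
  have z: "0 \<le> z" "z \<le> 1" by (auto simp: z_def)
  have "(\<integral>\<^sup>+x. ennreal (exp (w * (indicator E x - z))) \<partial>M)
     = (\<integral>\<^sup>+x. ennreal (exp (w * (1 - z))) * indicator E x +
                ennreal (exp (w * (0 - z))) * indicator (space M - E) x \<partial>M)"
    by (intro nn_integral_cong) (auto simp: indicator_def)
  also have "\<dots> = ennreal (exp (w * (1 - z))) * emeasure M E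
                  + ennreal (exp (w * (0 - z))) * emeasure M (space M - E)"
    using E by (simp add: nn_integral_add nn_integral_cmult)
  also have "\<dots> = ennreal (exp (w * (1 - z)) * z + exp (w * (0 - z)) * (1 - z))"
    using E z by (simp add: emeasure_eq_measure prob_compl z_def ennreal_plus flip: ennreal_mult)
  also have "\<dots> \<le> ennreal (exp (2/3 * w\<^sup>2 * (z * (1 - z))))"
  proof (rule ennreal_leI)
    have "\<bar>w * (1 - z)\<bar> \<le> 1/2 * 1" "\<bar>w * (0 - z)\<bar> \<le> 1/2 * 1"
      unfolding abs_mult using w z by (intro mult_mono; auto)+
    then have "exp (w * (1 - z)) * z + exp (w * (0 - z)) * (1 - z)
      \<le> (1 + w * (1 - z) + 2/3 * (w * (1 - z))\<^sup>2) * z + (1 + w * (0 - z) + 2/3 * (w * (0 - z))\<^sup>2) * (1 - z)"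
      using z by (intro add_mono mult_right_mono exp_le_quadratic) auto
    also have "\<dots> = 1 + 2/3 * w\<^sup>2 * (z * (1 - z))"
      by (simp add: power2_eq_square field_simps)
    also have "\<dots> \<le> exp (2/3 * w\<^sup>2 * (z * (1 - z)))"
      by (rule exp_ge_add_one_self)
    finally show "exp (w * (1 - z)) * z + exp (w * (0 - z)) * (1 - z) \<le> exp (2/3 * w\<^sup>2 * (z * (1 - z)))" .
  qed
  finally show ?thesis by (simp add: z_def)
qed

text \<open>Hoeffding's lemma for either sign of \<open>l\<close> (negative \<open>l\<close> by
  reflecting \<open>f\<close>), with the compensator \<open>l\<^sup>2 / 8\<close> moved inside so
  that the bound is 1, as a factor of an adapted product requires.\<close>

lemma (in prob_space) nn_integral_exp_unit_interval_le:
  fixes f :: "'a \<Rightarrow> real"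
  assumes f[measurable]: "f \<in> borel_measurable M" and AE: "AE x in M. f x \<in> {0..1}"
  shows "(\<integral>\<^sup>+x. ennreal (exp (l * (f x - expectation f) - l\<^sup>2 / 8)) \<partial>M) \<le> 1"
proof -
  have *: "(\<integral>\<^sup>+x. ennreal (exp (l * (g x - expectation g))) \<partial>M) \<le> ennreal (exp (l\<^sup>2 / 8))"
    if "l > 0" "g \<in> borel_measurable M" "AE x in M. g x \<in> {a..b}" "b - a = 1"
    for l :: real and g :: "'a \<Rightarrow> real" and a b
  proof -
    interpret interval_bounded_random_variable M g a b
      using that by unfold_locales auto
    show ?thesis using Hoeffdings_lemma_nn_integral[OF that(1)] that(4) by simp
  qed
  have "(\<integral>\<^sup>+x. ennreal (exp (l * (f x - expectation f))) \<partial>M) \<le> ennreal (exp (l\<^sup>2 / 8))"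
  proof -
    consider "l > 0" | "l = 0" | "l < 0" by linarith
    then show ?thesis
    proof cases
      case 1
      then show ?thesis using *[of l f 0 1] AE by simp
    next
      case 2
      then show ?thesis by (simp add: emeasure_space_1)
    next
      case 3
      have "AE x in M. - f x \<in> {-1..0}" using AE by eventually_elim auto
      then show ?thesis using *[of "-l" "\<lambda>x. - f x" "-1" 0] 3
        by (simp add: algebra_simps)
    qed
  qed
  then have "(\<integral>\<^sup>+x. ennreal (exp (- (l\<^sup>2 / 8))) * ennreal (exp (l * (f x - expectation f))) \<partial>M)
             \<le> ennreal (exp (- (l\<^sup>2 / 8))) * ennreal (exp (l\<^sup>2 / 8))"
    by (subst nn_integral_cmult) (auto intro: mult_left_mono)
  also have "\<dots> = 1" by (simp flip: ennreal_mult exp_add)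
  finally show ?thesis
    by (simp add: algebra_simps flip: ennreal_mult exp_add)
qed

text \<open>The running products form a supermartingale: integrate out the last coordinate first.\<close>

lemma nn_integral_prod_adapted_le_1:
  fixes N :: "nat \<Rightarrow> 'a measure" and g :: "nat \<Rightarrow> (nat \<Rightarrow> 'a) \<Rightarrow> 'a \<Rightarrow> ennreal"
  assumes N: "\<And>i. prob_space (N i)"
    and meas: "\<And>i. i < n \<Longrightarrow>
      (\<lambda>p. g i (snd p) (fst p)) \<in> borel_measurable (N (Suc i) \<Otimes>\<^sub>M PiM UNIV N)"
    and adapted: "\<And>i j X x \<xi>. i < n \<Longrightarrow> i < j \<Longrightarrow> g i (X(j := x)) \<xi> = g i X \<xi>"
    and le: "\<And>i \<omega>. i < n \<Longrightarrow> \<omega> \<in> space (PiM UNIV N) \<Longrightarrow> (\<integral>\<^sup>+\<xi>. g i \<omega> \<xi> \<partial>N (Suc i)) \<le> 1"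
  shows "(\<integral>\<^sup>+\<omega>. (\<Prod>i<n. g i \<omega> (\<omega> (Suc i))) \<partial>PiM UNIV N) \<le> 1"
  using meas adapted le
proof (induction n)
  case 0
  interpret P: prob_space "PiM UNIV N" using N by (intro prob_space_PiM) auto
  show ?case by (simp add: P.emeasure_space_1)
next
  case (Suc n)
  let ?P = "PiM UNIV N"
  interpret P: prob_space ?P using N by (intro prob_space_PiM) auto
  interpret Nn: prob_space "N (Suc n)" by (rule N)
  interpret pair_sigma_finite "N (Suc n)" ?P ..
  define F where "F = (\<lambda>\<omega>. \<Prod>i<n. g i \<omega> (\<omega> (Suc i)))"
  have gm: "(\<lambda>\<omega>. g i \<omega> (\<omega> (Suc i))) \<in> borel_measurable ?P" if "i < Suc n" for i
  proof -
    have "(\<lambda>\<omega>. (\<omega> (Suc i), \<omega>)) \<in> ?P \<rightarrow>\<^sub>M N (Suc i) \<Otimes>\<^sub>M ?P" by measurable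
    from measurable_comp[OF this Suc.prems(1)[OF that]] show ?thesis by (simp add: comp_def)
  qed
  have F[measurable]: "F \<in> borel_measurable ?P"
    unfolding F_def using gm by (intro borel_measurable_prod_ennreal) auto
  note [measurable] = gm[of n]
  note [measurable] = Suc.prems(1)[of n]
  have upd: "(\<lambda>p. (snd p)(Suc n := fst p)) \<in> N (Suc n) \<Otimes>\<^sub>M ?P \<rightarrow>\<^sub>M ?P"
    by (rule measurable_fun_upd[where J=UNIV]) auto
  have "(\<integral>\<^sup>+\<omega>. (\<Prod>i<Suc n. g i \<omega> (\<omega> (Suc i))) \<partial>?P) = (\<integral>\<^sup>+\<omega>. F \<omega> * g n \<omega> (\<omega> (Suc n)) \<partial>?P)"
    by (simp add: F_def)
  \<comment> \<open>Resampling coordinate \<open>Suc n\<close> from an independent copy preserves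
    the product measure; by adaptedness the fresh value then enters the last factor only.\<close>
  also have "\<dots> = (\<integral>\<^sup>+\<omega>. F \<omega> * g n \<omega> (\<omega> (Suc n))
       \<partial>(distr (N (Suc n) \<Otimes>\<^sub>M ?P) ?P (\<lambda>(x, X). X(Suc n := x))))"
    using distr_pair_PiM_eq_PiM[of UNIV N "Suc n"] N by simp
  also have "\<dots> = (\<integral>\<^sup>+p. F ((snd p)(Suc n := fst p)) * g n ((snd p)(Suc n := fst p)) (fst p)
       \<partial>(N (Suc n) \<Otimes>\<^sub>M ?P))"
    using upd by (subst nn_integral_distr) (auto simp: split_beta')
  also have "\<dots> = (\<integral>\<^sup>+p. F (snd p) * g n (snd p) (fst p) \<partial>(N (Suc n) \<Otimes>\<^sub>M ?P))"
    by (intro nn_integral_cong) (simp add: F_def Suc.prems(2))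
  also have "\<dots> = (\<integral>\<^sup>+X. (\<integral>\<^sup>+x. F X * g n X x \<partial>N (Suc n)) \<partial>?P)"
    by (subst nn_integral_snd[symmetric]) (auto simp: split_beta')
  also have "\<dots> \<le> (\<integral>\<^sup>+X. F X \<partial>?P)"
  proof (intro nn_integral_mono)
    fix X assume X: "X \<in> space ?P"
    have "(\<lambda>x. (x, X)) \<in> N (Suc n) \<rightarrow>\<^sub>M N (Suc n) \<Otimes>\<^sub>M ?P" using X by measurable
    from measurable_comp[OF this Suc.prems(1)[of n]]
    have [measurable]: "g n X \<in> borel_measurable (N (Suc n))" by (simp add: comp_def)
    have "(\<integral>\<^sup>+x. F X * g n X x \<partial>N (Suc n)) = F X * (\<integral>\<^sup>+x. g n X x \<partial>N (Suc n))"
      by (simp add: nn_integral_cmult)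
    also have "\<dots> \<le> F X * 1" using Suc.prems(3)[of n X] X by (intro mult_left_mono) auto
    finally show "(\<integral>\<^sup>+x. F X * g n X x \<partial>N (Suc n)) \<le> F X" by simp
  qed
  also have "\<dots> \<le> 1" unfolding F_def using Suc.prems by (intro Suc.IH) auto
  finally show ?case .
qed

text \<open>Markov's inequality for \<open>exp f\<close>, shared by both Chernoff arguments
  below.\<close>

lemma (in prob_space) prob_le_of_nn_integral_exp_le:
  assumes "(\<integral>\<^sup>+x. ennreal (exp (f x)) \<partial>M) \<le> ennreal (exp B)"
    and E: "E \<in> events" and ge: "\<And>x. x \<in> E \<Longrightarrow> b \<le> f x"
  shows "prob E \<le> exp (B - b)"
proof -
  have "ennreal (exp b) * emeasure M E = (\<integral>\<^sup>+x. ennreal (exp b) * indicator E x \<partial>M)"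
    using E by (simp add: nn_integral_cmult)
  also have "\<dots> \<le> (\<integral>\<^sup>+x. ennreal (exp (f x)) \<partial>M)"
    using ge by (intro nn_integral_mono) (auto simp: indicator_def intro!: ennreal_leI)
  also have "\<dots> \<le> ennreal (exp B)" by fact
  finally have "exp b * prob E \<le> exp B"
    by (simp add: emeasure_eq_measure flip: ennreal_mult)
  then show ?thesis by (simp add: exp_diff field_simps)
qed

text \<open>A Chernoff bound whose rate and signs are absorbed into the weights \<open>w\<close>, so
  that a difference of two half-block sums needs no separate treatment. Each factor ignores the past
  and is normalised by its own variance term.\<close>

lemma prob_bernoulli_sum_ge_le:
  fixes N :: "nat \<Rightarrow> 'a measure" and w :: "nat \<Rightarrow> real" and E :: "nat \<Rightarrow> 'a set"
  assumes N: "\<And>i. prob_space (N i)"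
    and E[measurable]: "\<And>i. i < n \<Longrightarrow> E (Suc i) \<in> sets (N (Suc i))"
    and w: "\<And>i. i < n \<Longrightarrow> \<bar>w (Suc i)\<bar> \<le> 1/2"
    and A: "A \<in> sets (PiM UNIV N)"
    and ge: "\<And>\<omega>. \<omega> \<in> A \<Longrightarrow>
      b \<le> (\<Sum>i<n. w (Suc i) * (indicator (E (Suc i)) (\<omega> (Suc i)) - measure (N (Suc i)) (E (Suc i))))"
  shows "measure (PiM UNIV N) A \<le>
    exp ((\<Sum>i<n. 2/3 * (w (Suc i))\<^sup>2 * (measure (N (Suc i)) (E (Suc i)) * (1 - measure (N (Suc i)) (E (Suc i))))) - b)"
proof -
  interpret P: prob_space "PiM UNIV N" using N by (intro prob_space_PiM) auto
  define q where "q = (\<lambda>i. measure (N (Suc i)) (E (Suc i)))"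
  define v where "v = (\<lambda>i. 2/3 * (w (Suc i))\<^sup>2 * (q i * (1 - q i)))"
  define g where "g = (\<lambda>i (\<omega>::nat \<Rightarrow> 'a) \<xi>. ennreal (exp (w (Suc i) * (indicator (E (Suc i)) \<xi> - q i) - v i)))"
  have "(\<integral>\<^sup>+\<omega>. (\<Prod>i<n. g i \<omega> (\<omega> (Suc i))) \<partial>PiM UNIV N) \<le> 1"
  proof (rule nn_integral_prod_adapted_le_1)
    fix i assume i: "i < n"
    note [measurable] = E[OF i]
    show "(\<lambda>p. g i (snd p) (fst p)) \<in> borel_measurable (N (Suc i) \<Otimes>\<^sub>M PiM UNIV N)"
      unfolding g_def by measurable
    fix \<omega>
    interpret Ni: prob_space "N (Suc i)" by (rule N)
    have "(\<integral>\<^sup>+\<xi>. g i \<omega> \<xi> \<partial>N (Suc i)) =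
      (\<integral>\<^sup>+\<xi>. ennreal (exp (- v i)) * ennreal (exp (w (Suc i) * (indicator (E (Suc i)) \<xi> - q i))) \<partial>N (Suc i))"
      unfolding g_def by (intro nn_integral_cong) (simp flip: ennreal_mult exp_add)
    also have "\<dots> = ennreal (exp (- v i)) * (\<integral>\<^sup>+\<xi>. ennreal (exp (w (Suc i) * (indicator (E (Suc i)) \<xi> - q i))) \<partial>N (Suc i))"
      by (rule nn_integral_cmult) measurable
    also have "\<dots> \<le> ennreal (exp (- v i)) * ennreal (exp (v i))"
      unfolding q_def v_def using w[OF i] E[OF i]
      by (intro mult_left_mono Ni.nn_integral_exp_bernoulli_le) auto
    also have "\<dots> = 1" by (simp flip: ennreal_mult exp_add)
    finally show "(\<integral>\<^sup>+\<xi>. g i \<omega> \<xi> \<partial>N (Suc i)) \<le> 1" .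
  qed (auto simp: g_def N)
  also have "(\<integral>\<^sup>+\<omega>. (\<Prod>i<n. g i \<omega> (\<omega> (Suc i))) \<partial>PiM UNIV N) =
     (\<integral>\<^sup>+\<omega>. ennreal (exp (\<Sum>i<n. w (Suc i) * (indicator (E (Suc i)) (\<omega> (Suc i)) - q i) - v i)) \<partial>PiM UNIV N)"
    unfolding g_def by (simp add: prod_ennreal exp_sum)
  finally have *: "\<dots> \<le> ennreal (exp 0)" by simp
  have "P.prob A \<le> exp (0 - (b - (\<Sum>i<n. v i)))"
  proof (rule P.prob_le_of_nn_integral_exp_le[OF * A])
    fix \<omega> assume "\<omega> \<in> A"
    from ge[OF this] show "b - (\<Sum>i<n. v i) \<le> (\<Sum>i<n. w (Suc i) * (indicator (E (Suc i)) (\<omega> (Suc i)) - q i) - v i)"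
      by (simp add: sum_subtractf q_def)
  qed
  then show ?thesis by (simp add: v_def q_def)
qed

section \<open>Measurability of the interaction\<close>

lemma trust_hat_subset: "trust_hat K H os k \<subseteq> {1..k}"
proof (induction k)
  case (Suc k)
  have "trust_hat K H os (Suc k) \<subseteq> insert (Suc k) (trust_hat K H os k)"
    unfolding trust_hat.simps Let_def by auto
  also have "\<dots> \<subseteq> insert (Suc k) {1..k}" using Suc by blast
  finally show ?case by auto
qed simp

lemma finite_trust_hat: "finite (trust_hat K H os k)"
  by (rule finite_subset[OF trust_hat_subset]) simp

text \<open>The recursion branches on the set found so far. Finite sets of naturals are countably
  many, so each step may be checked with that set held fixed.\<close>

lemma measurable_trust_hat:
  assumes ch: "\<And>j. 1 \<le> j \<Longrightarrow> j \<le> 2 * tam_m K H * k \<Longrightarrow>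
    (\<lambda>x. snd (snd (os x ! (j - 1)))) \<in> M \<rightarrow>\<^sub>M count_space UNIV"
  shows "(\<lambda>x. trust_hat K H (os x) k) \<in> M \<rightarrow>\<^sub>M count_space (Collect finite)"
  using ch
proof (induction k)
  case 0
  show ?case by simp
next
  case (Suc k)
  define m where "m = tam_m K H"
  have IH: "(\<lambda>x. trust_hat K H (os x) k) \<in> M \<rightarrow>\<^sub>M count_space (Collect finite)"
    using Suc.prems by (intro Suc.IH) auto
  have c[measurable]: "(\<lambda>x. chi_at (os x) (2*m*k + i)) \<in> borel_measurable M" if "1 \<le> i" "i \<le> 2*m" for i
  proof -
    have [measurable]: "Measurable.pred M (\<lambda>x. snd (snd (os x ! (2*m*k + i - 1))))"
      using that by (intro Suc.prems) (auto simp: m_def)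
    show ?thesis unfolding chi_at_def by measurable
  qed
  define Y1 where "Y1 = (\<lambda>x. (\<Sum>i=1..m. chi_at (os x) (2*m*k + i)) / real m)"
  define Y2 where "Y2 = (\<lambda>x. (\<Sum>i=m+1..2*m. chi_at (os x) (2*m*k + i)) / real m)"
  have Y[measurable]: "Y1 \<in> borel_measurable M" "Y2 \<in> borel_measurable M"
    unfolding Y1_def Y2_def
    by (intro borel_measurable_divide borel_measurable_sum borel_measurable_const c; auto)+
  define F where "F = (\<lambda>S x. let
          lam = (if card S = 0 then 1 / (5 * real (Suc k))
                 else if card S = Suc k - 1 then - 1 / (5 * real (Suc k)) else 0)
      in if Suc k = 1 then (if Y1 x + Y2 x \<ge> 1/2 then {1} else {})
         else (if Y2 x - Y1 x \<ge> lam then insert (Suc k) S else S))"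
  have "(\<lambda>x. F (trust_hat K H (os x) k) x) \<in> M \<rightarrow>\<^sub>M count_space (Collect finite)"
  proof (rule measurable_compose_countable'[OF _ IH countable_Collect_finite])
    fix S :: "nat set" assume "S \<in> Collect finite"
    then have "finite S" by simp
    then have [measurable]: "S \<in> space (count_space (Collect finite))"
      "insert (Suc k) S \<in> space (count_space (Collect finite))" by auto
    have [measurable]: "{1} \<in> space (count_space (Collect finite :: nat set set))"
      "{} \<in> space (count_space (Collect finite :: nat set set))" by auto
    show "F S \<in> M \<rightarrow>\<^sub>M count_space (Collect finite)"
      unfolding F_def Let_def
      by measurable
  qed
  also have "(\<lambda>x. F (trust_hat K H (os x) k) x) = (\<lambda>x. trust_hat K H (os x) (Suc k))"
    by (simp only: F_def Y1_def Y2_def m_def Let_def trust_hat.simps)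
  finally show ?case .
qed

lemma measurable_ucb:
  assumes len: "\<And>x. length (os x) = n"
    and ac: "\<And>i. i < n \<Longrightarrow> (\<lambda>x. fst (os x ! i)) \<in> M \<rightarrow>\<^sub>M count_space UNIV"
    and rw: "\<And>i. i < n \<Longrightarrow> (\<lambda>x. fst (snd (os x ! i))) \<in> borel_measurable M"
  shows "(\<lambda>x. ucb K H (os x) a) \<in> borel_measurable M"
proof -
  let ?I = "{tam_H0 K H + 1..<n + 1}"
  have ac'[measurable]: "Measurable.pred M (\<lambda>x. fst (os x ! (i - 1)) = a)" if "i \<in> ?I" for i
  proof -
    have [measurable]: "(\<lambda>x. fst (os x ! (i - 1))) \<in> M \<rightarrow>\<^sub>M count_space UNIV"
      using that by (intro ac) auto
    show ?thesis by measurable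
  qed
  have [measurable]: "(\<lambda>x. card {i \<in> ?I. fst (os x ! (i - 1)) = a}) \<in> M \<rightarrow>\<^sub>M count_space UNIV"
  proof (rule measurable_card)
    fix i
    show "{x \<in> space M. i \<in> {i \<in> ?I. fst (os x ! (i - 1)) = a}} \<in> sets M"
      using ac'[of i] by (cases "i \<in> ?I") (auto simp: pred_def)
  qed
  have [measurable]: "(\<lambda>x. \<Sum>i\<in>?I. if fst (os x ! (i - 1)) = a then fst (snd (os x ! (i - 1))) else 0)
     \<in> borel_measurable M"
  proof (rule borel_measurable_sum)
    fix i assume i: "i \<in> ?I"
    note [measurable] = ac'[OF i]
    have [measurable]: "(\<lambda>x. fst (snd (os x ! (i - 1)))) \<in> borel_measurable M"
      using i by (intro rw) auto
    show "(\<lambda>x. if fst (os x ! (i - 1)) = a then fst (snd (os x ! (i - 1))) else 0) \<in> borel_measurable M"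
      by measurable
  qed
  show ?thesis
    unfolding ucb_def Let_def len by measurable
qed

lemma measurable_pick_unif: "pick_unif A \<in> borel \<rightarrow>\<^sub>M count_space UNIV"
  unfolding pick_unif_def by measurable

text \<open>The same countability device twice: once for the estimated trust set and once for the
  set of UCB maximisers, after which only the tie-breaking variable remains.\<close>

lemma measurable_alg_choice:
  assumes len: "\<And>x. length (os x) = n"
    and ac: "\<And>i. i < n \<Longrightarrow> (\<lambda>x. fst (os x ! i)) \<in> M \<rightarrow>\<^sub>M count_space UNIV"
    and rw: "\<And>i. i < n \<Longrightarrow> (\<lambda>x. fst (snd (os x ! i))) \<in> borel_measurable M"
    and ch: "\<And>i. i < n \<Longrightarrow> (\<lambda>x. snd (snd (os x ! i))) \<in> M \<rightarrow>\<^sub>M count_space UNIV"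
    and tb[measurable]: "tb \<in> borel_measurable M"
  shows "(\<lambda>x. alg_choice K H (os x) (tb x)) \<in> M \<rightarrow>\<^sub>M count_space UNIV"
proof (cases "n + 1 \<le> tam_H0 K H")
  case True
  then show ?thesis by (simp add: alg_choice_def Let_def len)
next
  case False
  note [measurable] = measurable_ucb[OF len ac rw]
  define Cf where "Cf = (\<lambda>S. if S = {} then {1..K} else S)"
  define Af where "Af = (\<lambda>C x. {a \<in> C. \<forall>b\<in>C. ucb K H (os x) b \<le> ucb K H (os x) a})"
  have Th: "(\<lambda>x. trust_hat K H (os x) K) \<in> M \<rightarrow>\<^sub>M count_space (Collect finite)"
    using False by (intro measurable_trust_hat ch) (auto simp: tam_H0_def)
  have Am: "Af C \<in> M \<rightarrow>\<^sub>M count_space (Collect finite)" if C: "finite C" for C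
    unfolding measurable_count_space_eq_countable[OF countable_Collect_finite]
  proof (intro conjI ballI)
    show "Af C \<in> space M \<rightarrow> Collect finite" using C by (auto simp: Af_def)
    fix S :: "nat set" assume "S \<in> Collect finite"
    then have [simp]: "finite S" by simp
    have "Af C -` {S} \<inter> space M =
      {x\<in>space M. \<forall>a\<in>C \<union> S. a \<in> S \<longleftrightarrow> a \<in> C \<and> (\<forall>b\<in>C. ucb K H (os x) b \<le> ucb K H (os x) a)}"
      by (auto simp: Af_def)
    also have "\<dots> \<in> sets M" using C by measurable
    finally show "Af C -` {S} \<inter> space M \<in> sets M" .
  qed
  have pick: "(\<lambda>x. pick_unif (Af C x) (tb x)) \<in> M \<rightarrow>\<^sub>M count_space UNIV" if C: "finite C" for C
    by (rule measurable_compose_countable'[OF _ Am[OF C] countable_Collect_finite])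
       (rule measurable_compose[OF tb measurable_pick_unif])
  have "(\<lambda>x. pick_unif (Af (Cf (trust_hat K H (os x) K)) x) (tb x)) \<in> M \<rightarrow>\<^sub>M count_space UNIV"
    by (rule measurable_compose_countable'[OF _ Th countable_Collect_finite])
       (auto intro!: pick simp: Cf_def)
  also have "(\<lambda>x. pick_unif (Af (Cf (trust_hat K H (os x) K)) x) (tb x)) = (\<lambda>x. alg_choice K H (os x) (tb x))"
    using False by (auto simp: alg_choice_def Let_def len Af_def Cf_def fun_eq_iff)
  finally show ?thesis .
qed

lemma traj_append: "traj K H T \<omega> (Suc n) = traj K H T \<omega> n @ [next_entry K H T (traj K H T \<omega> n) (\<omega> (Suc n))]"
  by (simp add: Let_def)

declare traj.simps(2)[simp del]

lemma length_traj [simp]: "length (traj K H T \<omega> n) = n"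
  by (induction n) (auto simp: traj_append)

lemma traj_nth: "i < n \<Longrightarrow> traj K H T \<omega> n ! i = next_entry K H T (traj K H T \<omega> i) (\<omega> (Suc i))"
  by (induction n) (auto simp: traj_append nth_append less_Suc_eq)

lemma traj_cong:
  "(\<And>i. 1 \<le> i \<Longrightarrow> i \<le> n \<Longrightarrow> \<omega> i = \<omega>' i) \<Longrightarrow> traj K H T \<omega> n = traj K H T \<omega>' n"
  by (induction n) (auto simp: traj_append)

text \<open>An entry is handled through its components, so that no sigma-algebra on lists is needed.\<close>

definition measurable_entry :: "'b measure \<Rightarrow> ('b \<Rightarrow> hentry) \<Rightarrow> bool" where
  "measurable_entry M e \<longleftrightarrow>
     (\<lambda>x. fst (e x)) \<in> M \<rightarrow>\<^sub>M count_space UNIV \<and>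
     (\<lambda>x. fst (snd (e x))) \<in> M \<rightarrow>\<^sub>M count_space UNIV \<and>
     (\<lambda>x. fst (snd (snd (e x)))) \<in> borel_measurable M \<and>
     (\<lambda>x. snd (snd (snd (e x)))) \<in> M \<rightarrow>\<^sub>M count_space UNIV"

lemma measurable_trust_level:
  assumes len: "\<And>x. length (hs x) = n" and hs: "\<And>i. i < n \<Longrightarrow> measurable_entry M (\<lambda>x. hs x ! i)"
  shows "(\<lambda>x. trust_level T (hs x)) \<in> borel_measurable M"
proof -
  have "(\<lambda>x. length (filter (\<lambda>e. fst e \<in> S) (hs x))) \<in> M \<rightarrow>\<^sub>M count_space UNIV" for S
    unfolding length_filter_conv_card len
  proof (rule measurable_card)
    fix i
    show "{x \<in> space M. i \<in> {i. i < n \<and> fst (hs x ! i) \<in> S}} \<in> sets M"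
    proof (cases "i < n")
      case True
      then have [measurable]: "(\<lambda>x. fst (hs x ! i)) \<in> M \<rightarrow>\<^sub>M count_space UNIV"
        using hs by (simp add: measurable_entry_def)
      show ?thesis by measurable
    qed simp
  qed
  from this[of T] this[of "- T"] show ?thesis
    unfolding trust_level_def alpha_tr_def beta_tr_def by simp
qed

lemma measurable_next_entry:
  assumes len: "\<And>x. length (hs x) = n" and hs: "\<And>i. i < n \<Longrightarrow> measurable_entry M (\<lambda>x. hs x ! i)"
    and Rv[measurable]: "\<And>a. (\<lambda>x. fst (\<xi> x) a) \<in> borel_measurable M"
    and u[measurable]: "(\<lambda>x. fst (snd (\<xi> x))) \<in> borel_measurable M"
    and ao[measurable]: "(\<lambda>x. fst (snd (snd (\<xi> x)))) \<in> M \<rightarrow>\<^sub>M count_space UNIV"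
    and tb: "(\<lambda>x. snd (snd (snd (\<xi> x)))) \<in> borel_measurable M"
  shows "measurable_entry M (\<lambda>x. next_entry K H T (hs x) (\<xi> x))"
proof -
  have [measurable]: "(\<lambda>x. alg_choice K H (map snd (hs x)) (snd (snd (snd (\<xi> x))))) \<in> M \<rightarrow>\<^sub>M count_space UNIV"
    using hs by (intro measurable_alg_choice tb) (auto simp: len measurable_entry_def)
  note [measurable] = measurable_trust_level[OF len hs]
  define a where "a = (\<lambda>x. if fst (snd (\<xi> x)) < trust_level T (hs x)
     then alg_choice K H (map snd (hs x)) (snd (snd (snd (\<xi> x)))) else fst (snd (snd (\<xi> x))))"
  have a[measurable]: "a \<in> M \<rightarrow>\<^sub>M count_space UNIV" unfolding a_def by measurable
  \<comment> \<open>The index into the reward vector is itself random; it takes countably many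
    values.\<close>
  have [measurable]: "(\<lambda>x. fst (\<xi> x) (a x)) \<in> borel_measurable M"
    by (rule measurable_compose_countable[OF Rv a])
  have "next_entry K H T (hs x) (\<xi> x) = (alg_choice K H (map snd (hs x)) (snd (snd (snd (\<xi> x)))), a x,
     fst (\<xi> x) (a x), fst (snd (\<xi> x)) < trust_level T (hs x))" for x
    by (simp add: next_entry_def a_def split_beta Let_def)
  then show ?thesis
    unfolding measurable_entry_def by simp
qed

text \<open>The noise is an arbitrary measurable \<open>\<xi>\<close> so that the lemma serves both
  on \<open>P\<close> and on the product of one fresh factor with \<open>P\<close>. Entry
  \<open>i\<close> is a function of the earlier entries, hence strong induction on the
  position.\<close>

lemma measurable_traj:
  assumes Rv: "\<And>i a. (\<lambda>x. fst (\<xi> x i) a) \<in> borel_measurable M"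
    and u: "\<And>i. (\<lambda>x. fst (snd (\<xi> x i))) \<in> borel_measurable M"
    and ao: "\<And>i. (\<lambda>x. fst (snd (snd (\<xi> x i)))) \<in> M \<rightarrow>\<^sub>M count_space UNIV"
    and tb: "\<And>i. (\<lambda>x. snd (snd (snd (\<xi> x i)))) \<in> borel_measurable M"
  shows "i < n \<Longrightarrow> measurable_entry M (\<lambda>x. traj K H T (\<xi> x) n ! i)"
proof (induction i arbitrary: n rule: less_induct)
  case (less i)
  have "measurable_entry M (\<lambda>x. next_entry K H T (traj K H T (\<xi> x) i) (\<xi> x (Suc i)))"
    using less.IH by (intro measurable_next_entry assms) auto
  with less.prems show ?case by (simp add: traj_nth)
qed

section \<open>Error exponents of the block tests\<close>

text \<open>The previous bound on the window of times \<open>l + 1\<close> to \<open>l + r\<close>: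
  all coordinates up to \<open>l\<close> get weight 0 and the empty event.\<close>

lemma prob_bernoulli_block_sum_ge_le:
  fixes N :: "nat \<Rightarrow> 'a measure" and w z :: "nat \<Rightarrow> real" and E :: "nat \<Rightarrow> 'a set"
  assumes N: "\<And>i. prob_space (N i)"
    and E: "\<And>i. i \<in> {1..r} \<Longrightarrow> E i \<in> sets (N (l + i))"
    and z: "\<And>i. i \<in> {1..r} \<Longrightarrow> measure (N (l + i)) (E i) = z i"
    and w: "\<And>i. i \<in> {1..r} \<Longrightarrow> \<bar>w i\<bar> \<le> 1/2"
    and A: "A \<in> sets (PiM UNIV N)"
    and ge: "\<And>\<omega>. \<omega> \<in> A \<Longrightarrow> b \<le> (\<Sum>i=1..r. w i * (indicator (E i) (\<omega> (l + i)) - z i))"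
  shows "measure (PiM UNIV N) A \<le> exp ((\<Sum>i=1..r. 2/3 * (w i)\<^sup>2 * (z i * (1 - z i))) - b)"
proof -
  define E' where "E' = (\<lambda>h. if h > l then E (h - l) else {})"
  define w' where "w' = (\<lambda>h. if h > l then w (h - l) else 0)"
  have shift: "(\<Sum>i<l + r. f (Suc i)) = (\<Sum>i=1..r. f (l + i))" if "\<And>h. h \<le> l \<Longrightarrow> f h = 0" for f :: "nat \<Rightarrow> real"
  proof -
    have "(\<Sum>i<l + r. f (Suc i)) = (\<Sum>i\<in>{l..<l + r}. f (Suc i))"
      using that by (intro sum.mono_neutral_right) auto
    also have "\<dots> = (\<Sum>i=1..r. f (l + i))"
      by (rule sum.reindex_bij_witness[of _ "\<lambda>i. l + i - 1" "\<lambda>i. Suc i - l"]) auto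
    finally show ?thesis .
  qed
  have "measure (PiM UNIV N) A \<le>
    exp ((\<Sum>i<l + r. 2/3 * (w' (Suc i))\<^sup>2 * (measure (N (Suc i)) (E' (Suc i)) * (1 - measure (N (Suc i)) (E' (Suc i))))) - b)"
  proof (rule prob_bernoulli_sum_ge_le[OF N _ _ A])
    fix i assume "i < l + r"
    then have *: "l < Suc i \<Longrightarrow> Suc i - l \<in> {1..r}" by auto
    show "E' (Suc i) \<in> sets (N (Suc i))" "\<bar>w' (Suc i)\<bar> \<le> 1/2"
      using E[OF *] w[OF *] by (auto simp: E'_def w'_def)
  next
    fix \<omega> assume "\<omega> \<in> A"
    have "(\<Sum>i<l + r. w' (Suc i) * (indicator (E' (Suc i)) (\<omega> (Suc i)) - measure (N (Suc i)) (E' (Suc i))))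
        = (\<Sum>i=1..r. w' (l + i) * (indicator (E' (l + i)) (\<omega> (l + i)) - measure (N (l + i)) (E' (l + i))))"
      by (rule shift) (simp add: w'_def)
    also have "\<dots> = (\<Sum>i=1..r. w i * (indicator (E i) (\<omega> (l + i)) - z i))"
      by (intro sum.cong) (auto simp: w'_def E'_def z)
    finally show "b \<le> (\<Sum>i<l + r. w' (Suc i) * (indicator (E' (Suc i)) (\<omega> (Suc i)) - measure (N (Suc i)) (E' (Suc i))))"
      using ge[OF \<open>\<omega> \<in> A\<close>] by simp
  qed
  also have "(\<Sum>i<l + r. 2/3 * (w' (Suc i))\<^sup>2 * (measure (N (Suc i)) (E' (Suc i)) * (1 - measure (N (Suc i)) (E' (Suc i)))))
    = (\<Sum>i=1..r. 2/3 * (w' (l + i))\<^sup>2 * (measure (N (l + i)) (E' (l + i)) * (1 - measure (N (l + i)) (E' (l + i)))))"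
    by (rule shift) (simp add: w'_def)
  also have "\<dots> = (\<Sum>i=1..r. 2/3 * (w i)\<^sup>2 * (z i * (1 - z i)))"
    by (intro sum.cong) (auto simp: w'_def E'_def z)
  finally show ?thesis .
qed

text \<open>Bounds the expected number of surprises while arm 1 is recommended, which is tested
  against \<open>m / 2\<close>. The true order is logarithmic; replacing the first 19 terms by 1/2
  and the others by 1/20 is enough.\<close>

lemma sum_reciprocal_le:
  fixes m :: nat
  assumes "m \<ge> 150"
  shows "(\<Sum>i=1..2*m. 1 / (real i + 1)) \<le> real m / 5"
proof -
  have "(\<Sum>i=1..2*m. 1 / (real i + 1)) \<le> (\<Sum>i\<in>{1..2*m}. (if i < 20 then 1/2 else 0) + 1/20)"
  proof (intro sum_mono)
    fix i assume "i \<in> {1..2*m}"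
    then show "1 / (real i + 1) \<le> (if i < 20 then 1/2 else 0) + 1/20"
      by (auto simp: field_simps)
  qed
  also have "\<dots> = (\<Sum>i\<in>{1..2*m} \<inter> {i. i < 20}. 1/2) + real (2*m) / 20"
    by (simp add: sum.distrib sum.If_cases)
  also have "{1..2*m} \<inter> {i. i < 20} = {1..<20}" using assms by auto
  finally show ?thesis using assms by simp
qed

text \<open>Here \<open>b\<close> counts the earlier arms whose trust status differs from that of arm \<open>k\<close>. The threshold is
  the algorithm's \<open>\<lambda>\<^sub>k\<close>, with the sign flipped for untrusted arms; the rate nearly optimises the Chernoff bound.\<close>

definition block_threshold :: "nat \<Rightarrow> nat \<Rightarrow> real" where
  "block_threshold k b = (if b = 0 then - 1 / (5 * real k) else if b = k - 1 then 1 / (5 * real k) else 0)"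

definition block_rate :: "nat \<Rightarrow> nat \<Rightarrow> real" where
  "block_rate k b = (if b = 0 then 3 / (10 * real k) else 3 / (16 * real k))"

text \<open>Three regimes. For \<open>b = 0\<close> only \<open>\<Delta> \<ge> 0\<close> is used and
  the margin is the threshold itself. For \<open>b = k - 1\<close> the drift per sample exceeds the
  threshold by at least \<open>1 / (8 * k)\<close>. Otherwise the threshold is 0, and drift and
  variance are both proportional to \<open>B\<close>, with ratio of order \<open>1 / k\<close>. The
  last two regimes both end at \<open>45/64 * L\<close>, just above the stated
  \<open>5/8 * L\<close>; the first has room to spare.\<close>

lemma block_exponent:
  fixes m k b :: nat and L :: real
  defines "z \<equiv> \<lambda>i. (1 + 2 * real m * real b) / (2 + 2 * real m * (real k - 1) + (real i - 1))"
  defines "\<Delta> \<equiv> (\<Sum>i=1..m. z i) - (\<Sum>i=m+1..2*m. z i)"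
  assumes m: "m \<ge> 150" and k: "k \<ge> 2" and b: "b \<le> k - 1" and L: "L \<ge> 0" and mL: "real m \<ge> 30 * real k ^ 3 * L"
  shows "2/3 * (block_rate k b)\<^sup>2 * (\<Sum>i=1..2*m. z i * (1 - z i))
       - block_rate k b * (\<Delta> - real m * block_threshold k b) \<le> - (5/8) * L"
proof -
  define S where "S = 2 + 2 * real m * (real k - 1)"
  define B where "B = 1 + 2 * real m * real b"
  define V where "V = (\<Sum>i=1..2*m. z i * (1 - z i))"
  have k1: "real k \<ge> 2" "real m \<ge> 150" using k m by auto
  have bk: "real b \<le> real k - 1" using b k by linarith
  have Sge: "S \<ge> 2 * real m * (real k - 1)" by (simp add: S_def)
  have "2 * real m * 1 \<le> 2 * real m * (real k - 1)" using k1 by (intro mult_left_mono) auto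
  with Sge have S: "S \<ge> 2 * real m" by simp
  have B0: "B \<ge> 1" by (simp add: B_def)
  have BS: "B \<le> S" unfolding B_def S_def using mult_left_mono[OF bk, of "2 * real m"] by simp
  have zi: "z i = B / (S + (real i - 1))" for i by (simp add: z_def B_def S_def)
  have z01: "0 \<le> z i \<and> z i \<le> 1 \<and> z i \<le> B / S" if "i \<ge> 1" for i
  proof -
    have "z i \<le> B / S" unfolding zi using that B0 S k1 by (intro divide_left_mono) auto
    moreover have "B / S \<le> 1" using BS S k1 by (simp add: divide_simps)
    ultimately show ?thesis unfolding zi using that B0 S k1 by auto
  qed
  \<comment> \<open>Sample \<open>i\<close> of the first half is paired with sample
    \<open>i + m\<close> of the second; the denominators are then replaced by their largest
    values.\<close>
  have D1: "\<Delta> \<ge> real m * (real m * B / ((S + real m) * (S + 2 * real m)))"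
  proof -
    have "(\<Sum>i=m+1..2*m. z i) = (\<Sum>i=1..m. z (i + m))"
      by (rule sum.reindex_bij_witness[of _ "\<lambda>i. i + m" "\<lambda>i. i - m"]) auto
    then have "\<Delta> = (\<Sum>i=1..m. z i - z (i + m))" by (simp add: \<Delta>_def sum_subtractf)
    also have "\<dots> \<ge> (\<Sum>i=1..m. real m * B / ((S + real m) * (S + 2 * real m)))"
    proof (intro sum_mono)
      fix i assume i: "i \<in> {1..m}"
      then have i': "real i \<ge> 1" "real i \<le> real m" by auto
      have "z i - z (i + m) = real m * B / ((S + (real i - 1)) * (S + (real i + real m - 1)))"
        unfolding zi using i' S k1 by (simp add: field_simps)
      also have "\<dots> \<ge> real m * B / ((S + real m) * (S + 2 * real m))"
        using i' S k1 B0 by (intro divide_left_mono mult_mono mult_pos_pos) auto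
      finally show "real m * B / ((S + real m) * (S + 2 * real m)) \<le> z i - z (i + m)" .
    qed
    finally show ?thesis by simp
  qed
  have D0: "\<Delta> \<ge> 0" by (rule order_trans[OF _ D1]) (use B0 S k1 in auto)
  have V1: "V \<le> real m / 2"
  proof -
    have "V \<le> (\<Sum>i=1..2*m. 1/4)" unfolding V_def
    proof (intro sum_mono)
      fix i
      have "0 \<le> (z i - 1/2)\<^sup>2" by simp
      then show "z i * (1 - z i) \<le> 1/4" by (simp add: power2_eq_square algebra_simps)
    qed
    then show ?thesis by simp
  qed
  \<comment> \<open>Unlike \<open>V1\<close>, this bound sees that surprises are rare; it is the one
    used in the middle regime.\<close>
  have V2: "V \<le> 2 * real m * (B / S)"
  proof -
    have "V \<le> (\<Sum>i=1..2*m. B / S)" unfolding V_def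
    proof (intro sum_mono)
      fix i assume "i \<in> {1..2*m}"
      then have "0 \<le> z i \<and> z i \<le> 1 \<and> z i \<le> B / S" by (intro z01) auto
      then show "z i * (1 - z i) \<le> B / S"
        by (smt (verit) mult_left_le)
    qed
    then show ?thesis by simp
  qed
  have kpos: "real k > 0" using k1 by simp
  have cube: "real k ^ 3 \<ge> 2 * (real k)\<^sup>2"
    using k1 by (simp add: power3_eq_cube power2_eq_square)
  have mL2: "real m / (real k)\<^sup>2 \<ge> 60 * L"
  proof -
    have "60 * L * (real k)\<^sup>2 \<le> 30 * real k ^ 3 * L" using mult_left_mono[OF cube, of "30 * L"] L by (simp add: algebra_simps)
    then show ?thesis using mL kpos by (simp add: field_simps)
  qed
  have mL3: "real m / real k ^ 3 \<ge> 30 * L" using mL kpos by (simp add: field_simps)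
  consider (zero) "b = 0" | (full) "b \<noteq> 0" "b = k - 1" | (mid) "b \<noteq> 0" "b \<noteq> k - 1" by blast
  then have "2/3 * (block_rate k b)\<^sup>2 * V - block_rate k b * (\<Delta> - real m * block_threshold k b) \<le> - (5/8) * L"
  proof cases
    case zero
    have "2/3 * (3 / (10 * real k))\<^sup>2 * V - 3 / (10 * real k) * (\<Delta> - real m * (- 1 / (5 * real k)))
      \<le> 2/3 * (3 / (10 * real k))\<^sup>2 * (real m / 2) - 3 / (10 * real k) * (0 - real m * (- 1 / (5 * real k)))"
      using V1 D0 kpos by (intro diff_mono mult_left_mono) auto
    also have "\<dots> = - (3/100) * (real m / (real k)\<^sup>2)"
      using kpos by (simp add: field_simps power2_eq_square)
    also have "\<dots> \<le> - (3/100) * (60 * L)" using mL2 by simp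
    finally show ?thesis using L zero by (simp add: block_rate_def block_threshold_def)
  next
    case full
    have "real k - 1 = real b" using full k by auto
    then have SB: "S = B + 1" "real k = real b + 1" by (auto simp: S_def B_def)
    define s where "s = real b"
    have s: "s \<ge> 1" using full by (simp add: s_def)
    \<comment> \<open>For large \<open>m\<close> the quotient behind \<open>D1\<close>, multiplied
      by \<open>k\<close>, tends to \<open>s / (2 * s + 1)\<close>, which is at least 1/3; 13/40
      lies slightly below, and \<open>m \<ge> 150\<close> absorbs the terms of lower order.\<close>
    have DD: "\<Delta> \<ge> real m * (13/40 / real k)"
    proof -
      have "13/40 * ((S + real m) * (S + 2 * real m)) \<le> real k * (real m * B)"
      proof -
        have "real k * (real m * B) - 13/40 * ((S + real m) * (S + 2 * real m))
          = (real m)\<^sup>2 * (7/10 * s\<^sup>2 + 1/20 * s - 13/20) - real m * (8/5 * s + 19/20) - 13/10"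
          unfolding SB B_def s_def[symmetric] by (simp add: power2_eq_square field_simps)
        also have "\<dots> \<ge> 0"
        proof -
          have s2: "s\<^sup>2 \<ge> s" using s by (simp add: power2_eq_square)
          have "(real m)\<^sup>2 * (7/10 * s\<^sup>2 + 1/20 * s - 13/20) \<ge> (real m)\<^sup>2 * (1/10 * s)"
            using s s2 by (intro mult_left_mono) auto
          moreover have "(real m)\<^sup>2 * (1/10 * s) \<ge> 150 * real m * (1/10 * s)"
            using k1 s by (intro mult_right_mono) (auto simp: power2_eq_square)
          moreover have "real m * (8/5 * s + 19/20) + 13/10 \<le> 150 * real m * (1/10 * s)"
          proof -
            have "real m * 1 \<le> real m * s" using s by (intro mult_left_mono) auto
            then show ?thesis using k1 unfolding distrib_left by linarith
          qed
          ultimately show ?thesis by linarith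
        qed
        finally show ?thesis by simp
      qed
      then have "13/40 / real k \<le> real m * B / ((S + real m) * (S + 2 * real m))"
        using kpos S k1 by (simp add: divide_simps mult_ac)
      then show ?thesis using mult_left_mono[of _ _ "real m"] D1 by (meson of_nat_0_le_iff order_trans)
    qed
    have "2/3 * (3 / (16 * real k))\<^sup>2 * V - 3 / (16 * real k) * (\<Delta> - real m * (1 / (5 * real k)))
      \<le> 2/3 * (3 / (16 * real k))\<^sup>2 * (real m / 2) - 3 / (16 * real k) * (real m * (13/40 / real k) - real m * (1 / (5 * real k)))"
      using V1 DD kpos by (intro diff_mono mult_left_mono) auto
    also have "\<dots> = - (3/256) * (real m / (real k)\<^sup>2)"
      using kpos by (simp add: field_simps power2_eq_square)
    also have "\<dots> \<le> - (3/256) * (60 * L)" using mL2 by simp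
    finally show ?thesis using L full by (simp add: block_rate_def block_threshold_def)
  next
    case mid
    have k3: "real k \<ge> 3" using mid b k by linarith
    have "(S + real m) * (S + 2 * real m) = (2 * real m * real k)\<^sup>2 - real m * (real k * (2 * real m - 8)) - 2 * real m + 4"
      unfolding S_def by (simp add: power2_eq_square algebra_simps)
    also have "\<dots> \<le> (2 * real m * real k)\<^sup>2"
    proof -
      have "0 \<le> real m * (real k * (2 * real m - 8))" using k1 by (intro mult_nonneg_nonneg) auto
      then show ?thesis using k1 by linarith
    qed
    finally have den: "(S + real m) * (S + 2 * real m) \<le> 4 * (real m)\<^sup>2 * (real k)\<^sup>2" by (simp add: power_mult_distrib)
    have DD: "\<Delta> \<ge> B / (4 * (real k)\<^sup>2)"
    proof -
      have "B / (4 * (real k)\<^sup>2) = real m * (real m * B) / (4 * (real m)\<^sup>2 * (real k)\<^sup>2)"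
        using k1 by (simp add: power2_eq_square)
      also have "\<dots> \<le> real m * (real m * B) / ((S + real m) * (S + 2 * real m))"
        using den S k1 B0 by (intro divide_left_mono mult_pos_pos) auto
      finally show ?thesis using D1 by simp
    qed
    have VV: "V \<le> 3 * B / (2 * real k)"
    proof -
      have "2 * real m * (B / S) \<le> 2 * real m * (B / (2 * real m * (real k - 1)))"
        using Sge k1 B0 S by (intro mult_left_mono divide_left_mono mult_pos_pos) auto
      also have "\<dots> = B / (real k - 1)" using k1 by simp
      also have "\<dots> \<le> 3 * B / (2 * real k)"
      proof -
        have "B / (real k - 1) \<le> B / (2 / 3 * real k)" using k3 B0 by (intro divide_left_mono) auto
        then show ?thesis by simp
      qed
      finally show ?thesis using V2 by simp
    qed
    have "2/3 * (3 / (16 * real k))\<^sup>2 * V - 3 / (16 * real k) * (\<Delta> - real m * 0)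
      \<le> 2/3 * (3 / (16 * real k))\<^sup>2 * (3 * B / (2 * real k)) - 3 / (16 * real k) * (B / (4 * (real k)\<^sup>2) - real m * 0)"
      using VV DD kpos by (intro diff_mono mult_left_mono) auto
    also have "\<dots> = - (3/256) * (B / real k ^ 3)"
      using kpos by (simp add: field_simps power2_eq_square power3_eq_cube)
    also have "\<dots> \<le> - (3/256) * (2 * (real m / real k ^ 3))"
    proof -
      have "2 * real m * 1 \<le> 2 * real m * real b" using mid by (intro mult_left_mono) auto
      then have "B \<ge> 2 * real m" by (simp add: B_def)
      then have "B / real k ^ 3 \<ge> 2 * real m / real k ^ 3" using kpos by (intro divide_right_mono) auto
      then show ?thesis by simp
    qed
    also have "\<dots> \<le> - (3/256) * (2 * (30 * L))" using mL3 by simp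
    finally show ?thesis using L mid by (simp add: block_rate_def block_threshold_def)
  qed
  then show ?thesis by (simp add: V_def)
qed

section \<open>The noise space\<close>

locale trust_bandit =
  fixes K H :: nat and D :: "(nat \<Rightarrow> real) measure" and T :: "nat set" and own :: "nat \<Rightarrow> nat pmf"
  assumes K2: "K \<ge> 2" and H2: "H \<ge> 2" and inst: "trust_aware_instance K D T own"
begin

abbreviation "m \<equiv> tam_m K H"
abbreviation "H0 \<equiv> tam_H0 K H"
abbreviation "L \<equiv> ln (real H)"
abbreviation "tr \<equiv> traj K H T"
abbreviation "U \<equiv> uniform_measure lborel {0..1::real}"

definition N :: "nat \<Rightarrow> noise measure" where
  "N h = D \<Otimes>\<^sub>M (U \<Otimes>\<^sub>M (measure_pmf (own h) \<Otimes>\<^sub>M U))"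

abbreviation "P \<equiv> PiM UNIV N"

lemma noise_space_eq: "noise_space D own = P"
  unfolding noise_space_def N_def ..

lemma L_ge: "L \<ge> 2/3"
proof -
  have "(2::real)/3 \<le> ln 2" by (rule ln2_ge_two_thirds)
  also have "\<dots> \<le> L" using H2 by simp
  finally show ?thesis .
qed

lemma m_ge: "real m \<ge> 30 * real K ^ 3 * L"
  unfolding tam_m_def using L_ge by (simp add: real_nat_ceiling_ge)

lemma m_150: "m \<ge> 150"
proof -
  have "(2::real) ^ 3 \<le> real K ^ 3" using K2 by (intro power_mono) auto
  then have "8 * (2/3) \<le> real K ^ 3 * L" using L_ge by (intro mult_mono) auto
  then show ?thesis using m_ge by simp
qed

lemma m_le: "real m \<le> 30 * real K ^ 3 * L + 1"
  unfolding tam_m_def using L_ge by (simp add: of_nat_nat)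

sublocale D: prob_space D using inst by (simp add: trust_aware_instance_def)
sublocale U: prob_space U by (intro prob_space_uniform_measure) auto

lemma T_sub: "T \<subseteq> {1..K}" using inst by (simp add: trust_aware_instance_def)

lemma prob_space_N: "prob_space (N h)"
proof -
  have "prob_space (measure_pmf (own h) \<Otimes>\<^sub>M U)"
    by (intro prob_space_pair) (unfold_locales)
  then show ?thesis unfolding N_def
    by (intro prob_space_pair) unfold_locales
qed

sublocale P: product_prob_space N UNIV
  using prob_space_N by (unfold product_prob_space_def product_prob_space_axioms_def product_sigma_finite_def)
    (auto intro: prob_space_imp_sigma_finite)

text \<open>Stated for every index because own actions outside \<open>{1..K}\<close> are excluded
  only almost surely, so \<open>next_entry\<close> may read any coordinate. Those outside
  \<open>{1..K}\<close> are constantly \<open>undefined\<close>.\<close>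

lemma D_component [measurable]: "(\<lambda>x. x a) \<in> borel_measurable D"
proof -
  have s: "sets D = sets (PiM {1..K} (\<lambda>_. borel))" using inst by (simp add: trust_aware_instance_def)
  have "(\<lambda>x. x a) \<in> borel_measurable (PiM {1..K} (\<lambda>_. borel :: real measure))"
  proof (cases "a \<in> {1..K}")
    case True
    then show ?thesis by (rule measurable_component_singleton)
  next
    case False
    then have "x a = undefined" if "x \<in> space (PiM {1..K} (\<lambda>_. borel :: real measure))" for x
      using that by (auto simp: space_PiM PiE_def extensional_def)
    then show ?thesis by (subst measurable_cong[where g="\<lambda>_. undefined"]) auto
  qed
  then show ?thesis by (simp cong: measurable_cong_sets add: s)
qed

lemma N_components [measurable]:
  "(\<lambda>\<xi>. fst \<xi> a) \<in> borel_measurable (N h)"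
  "(\<lambda>\<xi>. fst (snd \<xi>)) \<in> borel_measurable (N h)"
  "(\<lambda>\<xi>. fst (snd (snd \<xi>))) \<in> N h \<rightarrow>\<^sub>M count_space UNIV"
  "(\<lambda>\<xi>. snd (snd (snd \<xi>))) \<in> borel_measurable (N h)"
proof -
  show "(\<lambda>\<xi>. fst \<xi> a) \<in> borel_measurable (N h)"
    unfolding N_def by (rule measurable_compose[OF measurable_fst D_component])
  have [measurable]: "fst \<in> U \<Otimes>\<^sub>M (measure_pmf (own h) \<Otimes>\<^sub>M U) \<rightarrow>\<^sub>M borel"
    "snd \<in> measure_pmf (own h) \<Otimes>\<^sub>M U \<rightarrow>\<^sub>M borel"
    "fst \<in> measure_pmf (own h) \<Otimes>\<^sub>M U \<rightarrow>\<^sub>M count_space UNIV"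
    using measurable_fst[of U "measure_pmf (own h) \<Otimes>\<^sub>M U"] measurable_snd[of "measure_pmf (own h)" U]
      measurable_fst[of "measure_pmf (own h)" U] by (simp_all cong: measurable_cong_sets)
  show "(\<lambda>\<xi>. fst (snd \<xi>)) \<in> borel_measurable (N h)"
    "(\<lambda>\<xi>. fst (snd (snd \<xi>))) \<in> N h \<rightarrow>\<^sub>M count_space UNIV"
    "(\<lambda>\<xi>. snd (snd (snd \<xi>))) \<in> borel_measurable (N h)"
    unfolding N_def by measurable
qed

lemma P_components [measurable]:
  "(\<lambda>\<omega>. fst (\<omega> h) a) \<in> borel_measurable P"
  "(\<lambda>\<omega>. fst (snd (\<omega> h))) \<in> borel_measurable P"
  "(\<lambda>\<omega>. fst (snd (snd (\<omega> h)))) \<in> P \<rightarrow>\<^sub>M count_space UNIV"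
  "(\<lambda>\<omega>. snd (snd (snd (\<omega> h)))) \<in> borel_measurable P"
proof -
  have [measurable]: "(\<lambda>\<omega>. \<omega> h) \<in> P \<rightarrow>\<^sub>M N h" by simp
  show "(\<lambda>\<omega>. fst (\<omega> h) a) \<in> borel_measurable P"
    "(\<lambda>\<omega>. fst (snd (\<omega> h))) \<in> borel_measurable P"
    "(\<lambda>\<omega>. fst (snd (snd (\<omega> h)))) \<in> P \<rightarrow>\<^sub>M count_space UNIV"
    "(\<lambda>\<omega>. snd (snd (snd (\<omega> h)))) \<in> borel_measurable P"
    by (rule measurable_compose[of "\<lambda>\<omega>. \<omega> h" P "N h"], simp, rule N_components)+
qed

text \<open>Yields both marginals used later, that of the trust uniform and that of the own action,
  by taking the other side to be everything.\<close>

lemma emeasure_N_rectangle: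
  assumes A: "A \<in> sets borel"
  shows "emeasure (N h) {\<xi>\<in>space (N h). fst (snd \<xi>) \<in> A \<and> fst (snd (snd \<xi>)) \<in> B}
     = emeasure U A * emeasure (measure_pmf (own h)) B"
proof -
  interpret Q: prob_space "measure_pmf (own h) \<Otimes>\<^sub>M U"
    by (intro prob_space_pair) unfold_locales
  interpret W: prob_space "U \<Otimes>\<^sub>M (measure_pmf (own h) \<Otimes>\<^sub>M U)"
    by (intro prob_space_pair) unfold_locales
  have "{\<xi>\<in>space (N h). fst (snd \<xi>) \<in> A \<and> fst (snd (snd \<xi>)) \<in> B} = space D \<times> (A \<times> (B \<times> space U))"
    by (auto simp: N_def space_pair_measure)
  also have "emeasure (N h) \<dots> = emeasure D (space D) * (emeasure U A * (emeasure (measure_pmf (own h)) B * emeasure U (space U)))"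
    unfolding N_def using A
    by (simp add: W.emeasure_pair_measure_Times Q.emeasure_pair_measure_Times U.emeasure_pair_measure_Times)
  finally show ?thesis using D.emeasure_space_1 U.emeasure_space_1 by simp
qed

lemma measure_N_uniform:
  assumes A: "A \<in> sets borel"
  shows "measure (N h) {\<xi>\<in>space (N h). fst (snd \<xi>) \<in> A} = measure U A"
  using emeasure_N_rectangle[OF A, of h UNIV] measure_pmf.emeasure_space_1[of "own h"]
  by (simp add: measure_def)

lemma measure_U_less:
  assumes "0 \<le> t" "t \<le> 1"
  shows "measure U {..<t} = t" "measure U {t..} = 1 - t"
proof -
  have "{0..1} \<inter> {..<t} = {0..<t}" "{0..1} \<inter> {t..} = {t..1}" using assms by auto
  then show "measure U {..<t} = t" "measure U {t..} = 1 - t"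
    using assms by (simp_all add: measure_uniform_measure)
qed

lemma measure_P_component:
  assumes "B \<in> sets (N h)"
  shows "measure P {\<omega>\<in>space P. \<omega> h \<in> B} = measure (N h) B"
proof -
  have "measure (N h) B = measure (distr P (N h) (\<lambda>\<omega>. \<omega> h)) B"
    using P.PiM_component[of h] by simp
  also have "\<dots> = measure P ((\<lambda>\<omega>. \<omega> h) -` B \<inter> space P)"
    using assms by (subst measure_distr) auto
  also have "(\<lambda>\<omega>. \<omega> h) -` B \<inter> space P = {\<omega>\<in>space P. \<omega> h \<in> B}" by auto
  finally show ?thesis by simp
qed

lemma AE_own: "AE \<omega> in P. \<forall>h. fst (snd (snd (\<omega> h))) \<in> {1..K}"
proof (subst AE_all_countable, intro allI)
  fix h
  have "emeasure (measure_pmf (own h)) (- {1..K}) = 0"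
    using inst by (auto simp: measure_pmf.emeasure_eq_measure measure_pmf_zero_iff trust_aware_instance_def)
  then have "emeasure (N h) {\<xi>\<in>space (N h). \<not> fst (snd (snd \<xi>)) \<in> {1..K}} = 0"
    using emeasure_N_rectangle[of UNIV h "- {1..K}"] by simp
  then have "AE \<xi> in N h. fst (snd (snd \<xi>)) \<in> {1..K}"
    by (subst AE_iff_measurable[OF _ refl]) auto
  then show "AE \<omega> in P. fst (snd (snd (\<omega> h))) \<in> {1..K}"
    by (intro AE_PiM_component prob_space_N) auto
qed

end

section \<open>Identification of the trust set\<close>

lemma alpha_tr_snoc: "alpha_tr T (hs @ [e]) = alpha_tr T hs + (if fst e \<in> T then 1 else 0)"
  by (simp add: alpha_tr_def)

lemma alpha_beta_tr: "alpha_tr T hs + beta_tr T hs = length hs + 2"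
  using sum_length_filter_compl[of "\<lambda>e. fst e \<in> T" hs] by (simp add: alpha_tr_def beta_tr_def)

lemma trust_level_eq: "trust_level T hs = real (alpha_tr T hs) / real (length hs + 2)"
  by (simp only: trust_level_def alpha_beta_tr)

context trust_bandit
begin

text \<open>Blocks are counted from 0, arms from 1: a history of length \<open>2 * m * k + i\<close>
  precedes time \<open>2 * m * k + i + 1\<close>, whose rounded-up quotient by \<open>2 * m\<close>
  is \<open>k + 1\<close>.\<close>

lemma alg_choice_stage1:
  assumes "length os = 2 * m * k + i" "i < 2 * m" "k < K"
  shows "alg_choice K H os tb = Suc k"
proof -
  have "2 * m * k + 2 * m \<le> H0"
    using mult_le_mono2[of "Suc k" K "2 * m"] assms by (simp add: tam_H0_def)
  then have "length os + 1 \<le> H0" using assms by linarith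
  moreover have "\<lceil>real (length os + 1) / real (2 * m)\<rceil> = int (Suc k)"
  proof (rule ceiling_unique)
    have "real (i + 1) \<le> real (2 * m)" using assms by linarith
    moreover have "real (length os + 1) / real (2 * m) = real k + real (i + 1) / real (2 * m)"
      using m_150 assms(1) by (simp add: field_simps)
    ultimately show "real_of_int (int (Suc k)) - 1 < real (length os + 1) / real (2 * m)"
      "real (length os + 1) / real (2 * m) \<le> real_of_int (int (Suc k))"
      using m_150 by (simp_all add: field_simps)
  qed
  ultimately show ?thesis by (simp add: alg_choice_def)
qed

lemma fst_next_entry: "fst (next_entry K H T hs \<xi>) = alg_choice K H (map snd hs) (snd (snd (snd \<xi>)))"
  by (simp add: next_entry_def split_beta Let_def)

text \<open>The right-hand side is free of \<open>\<omega>\<close>, which makes the Stage 1 trust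
  levels deterministic. The value \<open>i = 2 * m\<close> is included so that the end of one block
  is the start of the next.\<close>

lemma alpha_stage1:
  assumes "k < K" "i \<le> 2 * m"
  shows "alpha_tr T (tr \<omega> (2 * m * k + i)) = 1 + 2 * m * card (T \<inter> {1..k}) + (if Suc k \<in> T then i else 0)"
  using assms
proof (induction k arbitrary: i)
  case 0
  then show ?case
  proof (induction i)
    case 0
    show ?case by (simp add: alpha_tr_def)
  next
    case (Suc i)
    then have "alg_choice K H (map snd (tr \<omega> i)) tb = 1" for tb
      using alg_choice_stage1[of _ 0 i] by simp
    with Suc show ?case by (simp add: traj_append alpha_tr_snoc fst_next_entry)
  qed
next
  case (Suc k)
  from Suc.prems show ?case
  proof (induction i)
    case 0
    have "T \<inter> {1..Suc k} = (if Suc k \<in> T then insert (Suc k) (T \<inter> {1..k}) else T \<inter> {1..k})"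
      by (auto simp: atLeastAtMostSuc_conv)
    then have "card (T \<inter> {1..Suc k}) = card (T \<inter> {1..k}) + (if Suc k \<in> T then 1 else 0)" by simp
    moreover have "alpha_tr T (tr \<omega> (2 * m * Suc k)) = 1 + 2 * m * card (T \<inter> {1..k}) + (if Suc k \<in> T then 2 * m else 0)"
      using Suc.IH[of "2 * m"] Suc.prems by (simp add: algebra_simps)
    ultimately show ?case by simp
  next
    case (Suc i)
    then have "alg_choice K H (map snd (tr \<omega> (2 * m * Suc k + i))) tb = Suc (Suc k)" for tb
      using alg_choice_stage1[of _ "Suc k" i] by simp
    moreover have "alpha_tr T (tr \<omega> (2 * m * Suc k + i)) = 1 + 2 * m * card (T \<inter> {1..Suc k}) + (if Suc (Suc k) \<in> T then i else 0)"
      using Suc by simp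
    ultimately show ?case
      by (simp only: add_Suc_right traj_append alpha_tr_snoc fst_next_entry) simp
  qed
qed

text \<open>In block \<open>k\<close> (recommending arm \<open>Suc k\<close>) a \<^emph>\<open>surprise\<close> is a trust draw
  disagreeing with the membership of \<open>Suc k\<close> in \<open>T\<close>. Its probability decreases along the block
  whether or not the arm is trusted, which merges the two cases.\<close>

definition opp :: "nat \<Rightarrow> nat" where
  "opp k = card {j \<in> {1..k}. (j \<in> T) \<noteq> (Suc k \<in> T)}"

text \<open>Inside a block only the counter matching the status of \<open>Suc k\<close> grows, so
  the numerator, the opposite counter, stays fixed while the denominator increases. The form
  \<open>real (Suc k) - 1\<close> matches \<open>block_exponent\<close> at
  \<open>Suc k\<close>.\<close>

definition surprise_prob :: "nat \<Rightarrow> nat \<Rightarrow> real" where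
  "surprise_prob k i = (1 + 2 * real m * real (opp k)) / (2 + 2 * real m * (real (Suc k) - 1) + (real i - 1))"

definition block_trust :: "nat \<Rightarrow> nat \<Rightarrow> real" where
  "block_trust k i = (if Suc k \<in> T then 1 - surprise_prob k i else surprise_prob k i)"

definition surprise :: "nat \<Rightarrow> nat \<Rightarrow> noise set" where
  "surprise k i = {\<xi>\<in>space (N (2 * m * k + i)). (fst (snd \<xi>) < block_trust k i) \<noteq> (Suc k \<in> T)}"

lemma opp_le: "opp k \<le> k"
proof -
  have "opp k \<le> card {1..k}" unfolding opp_def by (intro card_mono) auto
  then show ?thesis by simp
qed

lemma opp_eq: "opp k = (if Suc k \<in> T then k - card (T \<inter> {1..k}) else card (T \<inter> {1..k}))"
proof (cases "Suc k \<in> T")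
  case True
  have "{j \<in> {1..k}. (j \<in> T) \<noteq> (Suc k \<in> T)} = {1..k} - T \<inter> {1..k}" using True by auto
  then show ?thesis using True by (simp add: opp_def card_Diff_subset)
next
  case False
  have "{j \<in> {1..k}. (j \<in> T) \<noteq> (Suc k \<in> T)} = T \<inter> {1..k}" using False by auto
  then show ?thesis using False by (simp add: opp_def)
qed

lemma card_T_le: "card (T \<inter> {1..k}) \<le> k"
proof -
  have "card (T \<inter> {1..k}) \<le> card {1..k}" by (intro card_mono) auto
  then show ?thesis by simp
qed

lemma surprise_prob_bounds:
  assumes "i \<ge> 1"
  shows "0 \<le> surprise_prob k i" "surprise_prob k i \<le> 1"
proof -
  have "real m * real (opp k) \<le> real m * real k" using opp_le by (intro mult_left_mono) auto
  then have "1 + 2 * real m * real (opp k) \<le> 2 + 2 * real m * (real (Suc k) - 1) + (real i - 1)"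
    using assms by simp
  moreover have "0 < 1 + 2 * real m * real (opp k)" by (simp add: add_pos_nonneg)
  ultimately show "0 \<le> surprise_prob k i" "surprise_prob k i \<le> 1"
    unfolding surprise_prob_def by (simp_all add: divide_le_eq_1)
qed

lemma trust_level_stage1:
  assumes "k < K" "1 \<le> i" "i \<le> 2 * m"
  shows "trust_level T (tr \<omega> (2 * m * k + i - 1)) = block_trust k i"
proof -
  define q where "q = card (T \<inter> {1..k})"
  have q: "q \<le> k" using card_T_le by (simp add: q_def)
  obtain j where j: "i = Suc j" using assms by (cases i) auto
  have "alpha_tr T (tr \<omega> (2 * m * k + (i - 1))) = 1 + 2 * m * q + (if Suc k \<in> T then i - 1 else 0)"
    unfolding q_def using assms by (intro alpha_stage1) auto
  moreover have "2 * m * k + i - 1 = 2 * m * k + (i - 1)" using assms by simp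
  ultimately have "trust_level T (tr \<omega> (2 * m * k + i - 1)) =
      real (1 + 2 * m * q + (if Suc k \<in> T then i - 1 else 0)) / real (2 * m * k + (i - 1) + 2)"
    by (simp only: trust_level_eq length_traj)
  then have t: "trust_level T (tr \<omega> (2 * m * k + i - 1)) =
      (1 + 2 * real m * real q + (if Suc k \<in> T then real i - 1 else 0)) / (2 + 2 * real m * real k + (real i - 1))"
    by (simp add: j add.assoc)
  define d where "d = 2 + 2 * real m * real k + (real i - 1)"
  have d: "d > 0" using assms by (simp add: d_def add_pos_nonneg)
  show ?thesis
  proof (cases "Suc k \<in> T")
    case True
    \<comment> \<open>For a trusted arm the opposite counter is \<open>beta_tr\<close>, built from
      the \<open>k - q\<close> earlier untrusted arms; its complement in \<open>d\<close> is
      \<open>alpha_tr\<close>.\<close>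
    have "block_trust k i = 1 - (1 + 2 * real m * (real k - real q)) / d"
      using True q by (simp add: block_trust_def surprise_prob_def opp_eq q_def d_def of_nat_diff)
    also have "\<dots> = (d - (1 + 2 * real m * (real k - real q))) / d"
      using d by (simp add: diff_divide_distrib)
    also have "d - (1 + 2 * real m * (real k - real q)) = 1 + 2 * real m * real q + (real i - 1)"
      by (simp add: d_def right_diff_distrib)
    finally show ?thesis unfolding t d_def[symmetric] using True by simp
  next
    case False
    then show ?thesis unfolding t by (simp add: block_trust_def surprise_prob_def opp_eq q_def)
  qed
qed

lemma chi_stage1:
  assumes "k < K" "1 \<le> i" "i \<le> 2 * m" "2 * m * k + i \<le> n" "\<omega> \<in> space P"
  shows "chi_at (map snd (tr \<omega> n)) (2 * m * k + i) =
    (if Suc k \<in> T then 1 - indicator (surprise k i) (\<omega> (2 * m * k + i)) else indicator (surprise k i) (\<omega> (2 * m * k + i)))"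
proof -
  have "\<omega> (2 * m * k + i) \<in> space (N (2 * m * k + i))" using assms(5) by (auto simp: space_PiM)
  moreover have "snd (snd (map snd (tr \<omega> n) ! (2 * m * k + i - 1))) =
     (fst (snd (\<omega> (2 * m * k + i))) < block_trust k i)"
    using assms trust_level_stage1[OF assms(1-3), of \<omega>]
    by (simp add: traj_nth next_entry_def split_beta Let_def)
  ultimately show ?thesis by (auto simp: chi_at_def surprise_def indicator_def)
qed

lemma surprise_sets [measurable]: "surprise k i \<in> sets (N (2 * m * k + i))"
  unfolding surprise_def by measurable

lemma measure_surprise:
  assumes "1 \<le> i"
  shows "measure (N (2 * m * k + i)) (surprise k i) = surprise_prob k i"
proof (cases "Suc k \<in> T")
  case True
  then have "surprise k i = {\<xi>\<in>space (N (2 * m * k + i)). fst (snd \<xi>) \<in> {1 - surprise_prob k i..}}"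
    by (auto simp: surprise_def block_trust_def)
  then have "measure (N (2 * m * k + i)) (surprise k i) = measure U {1 - surprise_prob k i..}"
    by (simp only: measure_N_uniform borel_closed closed_atLeast)
  also have "\<dots> = 1 - (1 - surprise_prob k i)"
    using surprise_prob_bounds[OF assms, of k] by (intro measure_U_less) auto
  finally show ?thesis by simp
next
  case False
  then have "surprise k i = {\<xi>\<in>space (N (2 * m * k + i)). fst (snd \<xi>) \<in> {..<surprise_prob k i}}"
    by (auto simp: surprise_def block_trust_def)
  then have "measure (N (2 * m * k + i)) (surprise k i) = measure U {..<surprise_prob k i}"
    by (simp only: measure_N_uniform borel_open open_lessThan)
  also have "\<dots> = surprise_prob k i"
    using surprise_prob_bounds[OF assms, of k] by (intro measure_U_less) auto
  finally show ?thesis .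
qed

abbreviation (input) "surp k i \<omega> \<equiv> (indicator (surprise k i) (\<omega> (2 * m * k + i)) :: real)"

text \<open>The event on which the test of arm \<open>Suc k\<close> may err, phrased with the true
  \<open>T\<close> rather than the estimate. The comparison is non-strict so that its complement is
  strict: an untrusted arm then falls strictly below the algorithm's threshold, which itself counts
  as acceptance.\<close>

definition bad_block :: "nat \<Rightarrow> (nat \<Rightarrow> noise) set" where
  "bad_block k = {\<omega>\<in>space P. if k = 0 then real m / 2 \<le> (\<Sum>i=1..2*m. surp k i \<omega>)
     else (\<Sum>i=1..m. surp k i \<omega>) - (\<Sum>i=m+1..2*m. surp k i \<omega>) \<le> real m * block_threshold (Suc k) (opp k)}"

lemma surp_measurable [measurable]: "(\<lambda>\<omega>. surp k i \<omega>) \<in> borel_measurable P"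
proof -
  have "(\<lambda>\<omega>. \<omega> (2 * m * k + i)) \<in> P \<rightarrow>\<^sub>M N (2 * m * k + i)" by simp
  from measurable_compose[OF this borel_measurable_indicator[OF surprise_sets]] show ?thesis .
qed

lemma bad_block_sets [measurable]: "bad_block k \<in> sets P"
  unfolding bad_block_def by measurable

lemma prob_bad_block_le:
  assumes "k < K"
  shows "measure P (bad_block k) \<le> exp (- (5/8) * L)"
proof (cases "k = 0")
  case True
  define \<Sigma> where "\<Sigma> = (\<Sum>i=1..2*m. surprise_prob 0 i)"
  have "opp 0 = 0" using opp_le[of 0] by simp
  then have z: "surprise_prob 0 i = 1 / (real i + 1)" for i by (simp add: surprise_prob_def add_ac)
  have S5: "\<Sigma> \<le> real m / 5" unfolding \<Sigma>_def z using m_150 by (rule sum_reciprocal_le)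
  \<comment> \<open>Rate 1/2 is the largest that the quadratic bound allows. The exponent is at most
    \<open>2/3 * \<Sigma> - m / 4\<close>, hence at most \<open>- 7/60 * m\<close>, and
    \<open>m \<ge> 30 * L\<close>.\<close>
  have "measure P (bad_block 0) \<le> exp ((\<Sum>i=1..2*m. 2/3 * (1/2)\<^sup>2 * (surprise_prob 0 i * (1 - surprise_prob 0 i))) - (1/2 * (real m / 2 - \<Sigma>)))"
  proof (rule prob_bernoulli_block_sum_ge_le[where l="2 * m * 0" and E="surprise 0", OF prob_space_N])
    fix \<omega> assume "\<omega> \<in> bad_block 0"
    then have "real m / 2 \<le> (\<Sum>i=1..2*m. surp 0 i \<omega>)" by (simp add: bad_block_def)
    then show "1/2 * (real m / 2 - \<Sigma>) \<le> (\<Sum>i=1..2*m. 1/2 * (surp 0 i \<omega> - surprise_prob 0 i))"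
      by (simp add: \<Sigma>_def flip: sum_divide_distrib add: sum_subtractf)
  qed (use surprise_sets[of 0] measure_surprise[of _ 0] in auto)
  also have "\<dots> \<le> exp (- (5/8) * L)"
  proof -
    have "(\<Sum>i=1..2*m. 2/3 * (1/2)\<^sup>2 * (surprise_prob 0 i * (1 - surprise_prob 0 i))) \<le> (\<Sum>i=1..2*m. 1/6 * surprise_prob 0 i)"
    proof (intro sum_mono)
      fix i assume "i \<in> {1..2*m}"
      then have "surprise_prob 0 i * (1 - surprise_prob 0 i) \<le> surprise_prob 0 i"
        using surprise_prob_bounds[of i 0] by (intro mult_left_le) auto
      then show "2/3 * (1/2)\<^sup>2 * (surprise_prob 0 i * (1 - surprise_prob 0 i)) \<le> 1/6 * surprise_prob 0 i"
        by (simp add: power2_eq_square)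
    qed
    also have "\<dots> = 1/6 * \<Sigma>" by (simp add: \<Sigma>_def sum_distrib_left)
    finally have *: "(\<Sum>i=1..2*m. 2/3 * (1/2)\<^sup>2 * (surprise_prob 0 i * (1 - surprise_prob 0 i))) \<le> 1/6 * \<Sigma>" .
    have "(1::real) ^ 3 \<le> real K ^ 3" using K2 by (intro power_mono) auto
    then have "30 * 1 * L \<le> 30 * real K ^ 3 * L" using L_ge by (intro mult_right_mono mult_left_mono) auto
    then have "30 * L \<le> real m" using m_ge by simp
    with * S5 L_ge show ?thesis by (subst exp_le_cancel_iff) argo
  qed
  finally show ?thesis using True by simp
next
  case False
  define r where "r = block_rate (Suc k) (opp k)"
  \<comment> \<open>The bad event is a lower tail of first half minus second half, so the first half
    gets the negative weight.\<close>
  define w where "w = (\<lambda>i. if i \<le> m then - r else r)"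
  define \<Delta> where "\<Delta> = (\<Sum>i=1..m. surprise_prob k i) - (\<Sum>i=m+1..2*m. surprise_prob k i)"
  define \<theta> where "\<theta> = block_threshold (Suc k) (opp k)"
  have r: "r > 0" "r \<le> 1/2" using False by (auto simp: r_def block_rate_def field_simps)
  have w2: "(w i)\<^sup>2 = r\<^sup>2" for i by (simp add: w_def)
  have split: "(\<Sum>i=1..2*m. w i * f i) = - r * ((\<Sum>i=1..m. f i) - (\<Sum>i=m+1..2*m. f i))" for f :: "nat \<Rightarrow> real"
  proof -
    have "{1..2*m} = {1..m} \<union> {m+1..2*m}" by auto
    then have "(\<Sum>i=1..2*m. w i * f i) = (\<Sum>i=1..m. w i * f i) + (\<Sum>i=m+1..2*m. w i * f i)"
      by (simp add: sum.union_disjoint)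
    also have "\<dots> = (\<Sum>i=1..m. - r * f i) + (\<Sum>i=m+1..2*m. r * f i)"
      by (simp add: w_def)
    finally show ?thesis by (simp add: sum_negf algebra_simps flip: sum_distrib_left)
  qed
  have "measure P (bad_block k) \<le> exp ((\<Sum>i=1..2*m. 2/3 * (w i)\<^sup>2 * (surprise_prob k i * (1 - surprise_prob k i))) - r * (\<Delta> - real m * \<theta>))"
  proof (rule prob_bernoulli_block_sum_ge_le[where l="2 * m * k" and E="surprise k", OF prob_space_N])
    fix \<omega> assume "\<omega> \<in> bad_block k"
    then have "(\<Sum>i=1..m. surp k i \<omega>) - (\<Sum>i=m+1..2*m. surp k i \<omega>) \<le> real m * \<theta>"
      using False by (simp add: bad_block_def \<theta>_def)
    then have "r * (\<Delta> - real m * \<theta>) \<le> r * (\<Delta> - ((\<Sum>i=1..m. surp k i \<omega>) - (\<Sum>i=m+1..2*m. surp k i \<omega>)))"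
      using r by (intro mult_left_mono) auto
    also have "\<dots> = (\<Sum>i=1..2*m. w i * (surp k i \<omega> - surprise_prob k i))"
      by (simp only: split sum_subtractf) (simp add: \<Delta>_def algebra_simps)
    finally show "r * (\<Delta> - real m * \<theta>) \<le> (\<Sum>i=1..2*m. w i * (surp k i \<omega> - surprise_prob k i))" .
  qed (use r in \<open>auto intro: surprise_sets measure_surprise simp: w_def\<close>)
  also have "(\<Sum>i=1..2*m. 2/3 * (w i)\<^sup>2 * (surprise_prob k i * (1 - surprise_prob k i)))
     = 2/3 * r\<^sup>2 * (\<Sum>i=1..2*m. surprise_prob k i * (1 - surprise_prob k i))"
    unfolding w2 by (simp add: sum_distrib_left)
  also have "exp (2/3 * r\<^sup>2 * (\<Sum>i=1..2*m. surprise_prob k i * (1 - surprise_prob k i)) - r * (\<Delta> - real m * \<theta>)) \<le> exp (- (5/8) * L)"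
  proof (subst exp_le_cancel_iff)
    have "real (Suc k) ^ 3 \<le> real K ^ 3" using assms by (intro power_mono) auto
    then have "30 * real (Suc k) ^ 3 * L \<le> 30 * real K ^ 3 * L" using L_ge by (intro mult_right_mono mult_left_mono) auto
    then have "30 * real (Suc k) ^ 3 * L \<le> real m" using m_ge by simp
    then show "2/3 * r\<^sup>2 * (\<Sum>i=1..2*m. surprise_prob k i * (1 - surprise_prob k i)) - r * (\<Delta> - real m * \<theta>) \<le> - (5/8) * L"
      unfolding r_def \<Delta>_def \<theta>_def surprise_prob_def
      using False m_150 L_ge opp_le[of k] by (intro block_exponent) auto
  qed
  finally show ?thesis .
qed

text \<open>As long as the earlier arms are classified correctly, the algorithm's threshold equals
  \<open>block_threshold\<close> up to the sign given by the status of the arm, so a good block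
  extends the correct set. Errors cannot propagate because the bad events do not mention the
  estimate.\<close>

lemma trust_hat_eq:
  assumes \<omega>: "\<omega> \<in> space P" and good: "\<And>k. k < K \<Longrightarrow> \<omega> \<notin> bad_block k" and n: "H0 \<le> n" and k: "k \<le> K"
  shows "trust_hat K H (map snd (tr \<omega> n)) k = T \<inter> {1..k}"
  using k
proof (induction k)
  case (Suc k)
  define os where "os = map snd (tr \<omega> n)"
  have IH: "trust_hat K H os k = T \<inter> {1..k}" using Suc by (simp add: os_def)
  have kK: "k < K" using Suc by simp
  define s1 where "s1 = (\<Sum>i=1..m. surp k i \<omega>)"
  define s2 where "s2 = (\<Sum>i=m+1..2*m. surp k i \<omega>)"
  define Y1 where "Y1 = (\<Sum>i=1..m. chi_at os (2*m*k + i)) / real m"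
  define Y2 where "Y2 = (\<Sum>i=m+1..2*m. chi_at os (2*m*k + i)) / real m"
  have le: "2 * m * k + i \<le> n" if "i \<le> 2 * m" for i
    using mult_le_mono2[of "Suc k" K "2 * m"] kK n that by (simp add: tam_H0_def)
  have chi: "chi_at os (2 * m * k + i) = (if Suc k \<in> T then 1 - surp k i \<omega> else surp k i \<omega>)"
    if "1 \<le> i" "i \<le> 2 * m" for i
    unfolding os_def using chi_stage1[OF kK that le[OF that(2)] \<omega>] .
  have c1: "(\<Sum>i=1..m. chi_at os (2*m*k + i)) = (\<Sum>i=1..m. if Suc k \<in> T then 1 - surp k i \<omega> else surp k i \<omega>)"
    by (intro sum.cong refl chi) auto
  have c2: "(\<Sum>i=m+1..2*m. chi_at os (2*m*k + i)) = (\<Sum>i=m+1..2*m. if Suc k \<in> T then 1 - surp k i \<omega> else surp k i \<omega>)"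
    by (intro sum.cong refl chi) auto
  have mpos: "real m > 0" using m_150 by simp
  have Y: "Y1 = (if Suc k \<in> T then 1 - s1 / real m else s1 / real m)"
    "Y2 = (if Suc k \<in> T then 1 - s2 / real m else s2 / real m)"
    unfolding Y1_def Y2_def c1 c2 s1_def s2_def using mpos
    by (auto simp: sum_subtractf field_simps)
  define q where "q = card (T \<inter> {1..k})"
  define lam where "lam = (if card (T \<inter> {1..k}) = 0 then 1 / (5 * real (Suc k))
                 else if card (T \<inter> {1..k}) = Suc k - 1 then - 1 / (5 * real (Suc k)) else 0)"
  have step: "trust_hat K H os (Suc k) = (if Suc k = 1 then (if Y1 + Y2 \<ge> 1/2 then {1} else {})
         else (if Y2 - Y1 \<ge> lam then insert (Suc k) (T \<inter> {1..k}) else T \<inter> {1..k}))"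
    by (simp only: trust_hat.simps Let_def IH Y1_def Y2_def lam_def)
  have T_Suc: "T \<inter> {1..Suc k} = (if Suc k \<in> T then insert (Suc k) (T \<inter> {1..k}) else T \<inter> {1..k})"
    by (auto simp: atLeastAtMostSuc_conv)
  have "trust_hat K H os (Suc k) = T \<inter> {1..Suc k}"
  proof (cases "k = 0")
    case True
    have "{1..2*m} = {1..m} \<union> {m+1..2*m}" by auto
    then have "(\<Sum>i=1..2*m. surp 0 i \<omega>) = s1 + s2"
      unfolding s1_def s2_def True by (simp add: sum.union_disjoint)
    moreover have "\<omega> \<notin> bad_block 0" using good[of 0] K2 by simp
    ultimately have "(s1 + s2) / real m < 1 / 2" using \<omega> mpos by (simp add: bad_block_def field_simps)
    then have "(Y1 + Y2 \<ge> 1/2) = (1 \<in> T)" unfolding Y using True by (auto simp: add_divide_distrib)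
    then show ?thesis unfolding step T_Suc using True by simp
  next
    case False
    have "s1 - s2 > real m * block_threshold (Suc k) (opp k)"
      using good[OF kK] \<omega> False by (simp add: bad_block_def s1_def s2_def)
    then have *: "s1 / real m - s2 / real m > block_threshold (Suc k) (opp k)"
      using mpos by (simp add: field_simps)
    have "(Y2 - Y1 \<ge> lam) = (Suc k \<in> T)"
    proof (cases "Suc k \<in> T")
      case True
      then have "block_threshold (Suc k) (opp k) = lam"
        using False card_T_le[of k] unfolding block_threshold_def opp_eq lam_def q_def[symmetric] by auto
      then show ?thesis unfolding Y using True * by simp
    next
      case F: False
      then have "block_threshold (Suc k) (opp k) = - lam"
        using False card_T_le[of k] unfolding block_threshold_def opp_eq lam_def q_def[symmetric] by auto
      then show ?thesis unfolding Y using F * by simp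
    qed
    then show ?thesis unfolding step T_Suc using False by simp
  qed
  then show ?case by (simp add: os_def)
qed simp

end

section \<open>Concentration of the confidence bounds\<close>

lemma pick_unif_mem:
  assumes "finite A" "A \<noteq> {}"
  shows "pick_unif A u \<in> A"
proof -
  have "card A > 0" using assms by (simp add: card_gt_0_iff)
  then have "min (card A - 1) (nat \<lfloor>u * real (card A)\<rfloor>) < length (sorted_list_of_set A)"
    using assms by simp
  then have "pick_unif A u \<in> set (sorted_list_of_set A)" unfolding pick_unif_def by (rule nth_mem)
  then show ?thesis using assms by simp
qed

lemma argmax_nonempty:
  fixes f :: "nat \<Rightarrow> real"
  assumes "finite C" "C \<noteq> {}"
  shows "{a \<in> C. \<forall>b\<in>C. f b \<le> f a} \<noteq> {}"
proof -
  have "Max (f ` C) \<in> f ` C" using assms by (intro Max_in) auto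
  then obtain a where "a \<in> C" "f a = Max (f ` C)" by auto
  then have "a \<in> {a \<in> C. \<forall>b\<in>C. f b \<le> f a}" using assms by simp
  then show ?thesis by blast
qed

lemma alg_choice_stage2:
  assumes "tam_H0 K H \<le> length os" "K \<ge> 1"
  defines "C \<equiv> if trust_hat K H os K = {} then {1..K} else trust_hat K H os K"
  shows "alg_choice K H os tb \<in> C" "\<And>b. b \<in> C \<Longrightarrow> ucb K H os b \<le> ucb K H os (alg_choice K H os tb)"
proof -
  have C: "finite C" "C \<noteq> {}" using finite_trust_hat assms by (auto simp: C_def)
  let ?A = "{a \<in> C. \<forall>b\<in>C. ucb K H os b \<le> ucb K H os a}"
  have "alg_choice K H os tb = pick_unif ?A tb" using assms(1) by (simp add: alg_choice_def Let_def C_def)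
  also have "\<dots> \<in> ?A" using C argmax_nonempty[OF C] by (intro pick_unif_mem) auto
  finally show "alg_choice K H os tb \<in> C" "\<And>b. b \<in> C \<Longrightarrow> ucb K H os b \<le> ucb K H os (alg_choice K H os tb)"
    by auto
qed

context trust_bandit
begin

lemma alg_choice_range: "alg_choice K H os tb \<in> {1..K}"
proof (cases "length os < H0")
  case True
  define k where "k = length os div (2 * m)"
  have "k < K" unfolding k_def using True m_150
    by (subst div_less_iff_less_mult) (auto simp: tam_H0_def mult_ac)
  moreover have "alg_choice K H os tb = Suc k"
    using \<open>k < K\<close> m_150 by (intro alg_choice_stage1[where i="length os mod (2 * m)"]) (auto simp: k_def)
  ultimately show ?thesis by simp
next
  case False
  then show ?thesis using alg_choice_stage2(1)[of K H os tb] trust_hat_subset[of K H os K] K2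
    by (auto split: if_splits)
qed

abbreviation "r \<equiv> arm_mean D"

text \<open>Indexed from 0: \<open>act i\<close> is the pull at time \<open>i + 1\<close>, decided
  after the history \<open>tr \<omega> i\<close>. Index set \<open>{H0..<n}\<close> therefore means
  times \<open>H0 + 1\<close> to \<open>n\<close>.\<close>

definition act :: "nat \<Rightarrow> (nat \<Rightarrow> noise) \<Rightarrow> nat" where
  "act i \<omega> = fst (snd (next_entry K H T (tr \<omega> i) (\<omega> (Suc i))))"

definition chi :: "nat \<Rightarrow> (nat \<Rightarrow> noise) \<Rightarrow> bool" where
  "chi i \<omega> \<longleftrightarrow> fst (snd (\<omega> (Suc i))) < trust_level T (tr \<omega> i)"

definition cnt :: "nat \<Rightarrow> nat \<Rightarrow> (nat \<Rightarrow> noise) \<Rightarrow> nat" where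
  "cnt a n \<omega> = card {i \<in> {H0..<n}. act i \<omega> = a}"

definition rew_sum :: "nat \<Rightarrow> nat \<Rightarrow> (nat \<Rightarrow> noise) \<Rightarrow> real" where
  "rew_sum a n \<omega> = (\<Sum>i\<in>{H0..<n}. if act i \<omega> = a then fst (\<omega> (Suc i)) a else 0)"

lemma act_eq:
  "act i \<omega> = (if chi i \<omega> then alg_choice K H (map snd (tr \<omega> i)) (snd (snd (snd (\<omega> (Suc i))))) else fst (snd (snd (\<omega> (Suc i)))))"
  by (simp add: act_def chi_def next_entry_def split_beta Let_def)

lemma traj_upd: "i < j \<Longrightarrow> tr (X(j := x)) i = tr X i"
  by (rule traj_cong) auto

lemma act_measurable [measurable]: "act i \<in> P \<rightarrow>\<^sub>M count_space UNIV"
proof -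
  have "measurable_entry P (\<lambda>\<omega>. tr \<omega> (Suc i) ! i)"
    by (rule measurable_traj) (auto intro: P_components)
  then show ?thesis by (simp add: measurable_entry_def traj_nth act_def[abs_def])
qed

lemma cnt_measurable [measurable]: "cnt a n \<in> P \<rightarrow>\<^sub>M count_space UNIV"
  unfolding cnt_def by measurable

lemma rew_sum_measurable [measurable]: "rew_sum a n \<in> borel_measurable P"
  unfolding rew_sum_def by measurable

lemma rewards_AE: "a \<in> {1..K} \<Longrightarrow> AE x in D. x a \<in> {0..1}"
proof -
  assume a: "a \<in> {1..K}"
  have "AE x in D. \<forall>k\<in>{1..K}. 0 \<le> x k \<and> x k \<le> 1" using inst by (simp add: trust_aware_instance_def)
  then show ?thesis by eventually_elim (use a in auto)
qed

lemma r_bounds: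
  assumes "a \<in> {1..K}"
  shows "0 \<le> r a" "r a \<le> 1"
proof -
  have "AE x in D. 0 \<le> x a" "AE x in D. x a \<le> 1" using rewards_AE[OF assms] by (auto elim: eventually_mono)
  moreover have "integrable D (\<lambda>x. x a)"
    by (rule D.integrable_const_bound[where B=1]) (use rewards_AE[OF assms] in \<open>auto elim: eventually_mono\<close>)
  ultimately show "0 \<le> r a" "r a \<le> 1"
    unfolding arm_mean_def by (auto intro: integral_nonneg_AE D.integral_le_const)
qed

text \<open>A pull of \<open>a\<close> contributes a compensated exponential of mean at most 1,
  every other step the factor 1. Since the compensator counts the actual pulls, the adaptive choice
  of arms does no harm.\<close>

lemma nn_integral_ucb_supermartingale:
  assumes a: "a \<in> {1..K}"
  shows "(\<integral>\<^sup>+\<omega>. ennreal (exp (l * (rew_sum a n \<omega> - real (cnt a n \<omega>) * r a) - real (cnt a n \<omega>) * (l\<^sup>2 / 8))) \<partial>P) \<le> 1"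
proof -
  define c where "c = (\<lambda>x. l * (x - r a) - l\<^sup>2 / 8)"
  define g where "g = (\<lambda>i \<omega> \<xi>. ennreal (exp (if H0 \<le> i \<and> fst (snd (next_entry K H T (tr \<omega> i) \<xi>)) = a then c (fst \<xi> a) else 0)))"
  have "(\<integral>\<^sup>+\<omega>. (\<Prod>i<n. g i \<omega> (\<omega> (Suc i))) \<partial>P) \<le> 1"
  proof (rule nn_integral_prod_adapted_le_1[OF prob_space_N])
    fix i assume "i < n"
    let ?M = "N (Suc i) \<Otimes>\<^sub>M P"
    have sndc: "(\<lambda>p. f (snd p h)) \<in> ?M \<rightarrow>\<^sub>M X" if "f \<in> N h \<rightarrow>\<^sub>M X" for f :: "noise \<Rightarrow> 'z" and X h
    proof -
      have "(\<lambda>p. snd p h) \<in> ?M \<rightarrow>\<^sub>M N h" by measurable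
      from measurable_compose[OF this that] show ?thesis .
    qed
    have fstc: "(\<lambda>p. f (fst p)) \<in> ?M \<rightarrow>\<^sub>M X" if "f \<in> N (Suc i) \<rightarrow>\<^sub>M X" for f :: "noise \<Rightarrow> 'z" and X
      by (rule measurable_compose[OF measurable_fst that])
    have "measurable_entry ?M (\<lambda>p. next_entry K H T (tr (snd p) i) (fst p))"
    proof (rule measurable_next_entry[where n=i])
      show "measurable_entry ?M (\<lambda>p. tr (snd p) i ! j)" if "j < i" for j
        using that by (intro measurable_traj sndc N_components)
    qed (auto intro: fstc N_components)
    then have [measurable]: "(\<lambda>p. fst (snd (next_entry K H T (tr (snd p) i) (fst p)))) \<in> ?M \<rightarrow>\<^sub>M count_space UNIV"
      by (simp add: measurable_entry_def)
    have [measurable]: "(\<lambda>p. fst (fst p) a) \<in> borel_measurable ?M" by (intro fstc N_components)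
    show "(\<lambda>p. g i (snd p) (fst p)) \<in> borel_measurable ?M"
      unfolding g_def c_def by measurable
    show "g i (X(j := x)) \<xi> = g i X \<xi>" if "i < j" for j X x \<xi>
      using that by (simp add: g_def traj_upd)
    fix \<omega> assume \<omega>: "\<omega> \<in> space P"
    have gm: "g i \<omega> \<in> borel_measurable (N (Suc i))"
    proof -
      have "(\<lambda>x. (x, \<omega>)) \<in> N (Suc i) \<rightarrow>\<^sub>M ?M" using \<omega> by measurable
      from measurable_compose[OF this \<open>(\<lambda>p. g i (snd p) (fst p)) \<in> borel_measurable ?M\<close>]
      show ?thesis by simp
    qed
    let ?W = "U \<Otimes>\<^sub>M (measure_pmf (own (Suc i)) \<Otimes>\<^sub>M U)"
    interpret Q: prob_space "measure_pmf (own (Suc i)) \<Otimes>\<^sub>M U"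
      by (intro prob_space_pair) unfold_locales
    interpret W: prob_space ?W by (intro prob_space_pair) unfold_locales
    interpret DW: pair_sigma_finite D ?W ..
    \<comment> \<open>The reward vector is integrated first: past, trust draw, own action and
      tie-breaking already fix the pulled arm, and the reward is independent of them.\<close>
    have "(\<integral>\<^sup>+\<xi>. g i \<omega> \<xi> \<partial>N (Suc i)) = (\<integral>\<^sup>+w. (\<integral>\<^sup>+x. g i \<omega> (x, w) \<partial>D) \<partial>?W)"
      using gm unfolding N_def by (subst DW.nn_integral_snd) auto
    also have "\<dots> \<le> (\<integral>\<^sup>+w. 1 \<partial>?W)"
    proof (intro nn_integral_mono)
      fix w
      define b where "b = (if fst w < trust_level T (tr \<omega> i) then alg_choice K H (map snd (tr \<omega> i)) (snd (snd w)) else fst (snd w))"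
      have "g i \<omega> (x, w) = (if H0 \<le> i \<and> b = a then ennreal (exp (c (x a))) else 1)" for x
        by (auto simp: g_def next_entry_def split_beta Let_def b_def)
      moreover have "(\<integral>\<^sup>+x. ennreal (exp (c (x a))) \<partial>D) \<le> 1"
        unfolding c_def arm_mean_def
        by (rule D.nn_integral_exp_unit_interval_le[OF D_component rewards_AE[OF a]])
      ultimately show "(\<integral>\<^sup>+x. g i \<omega> (x, w) \<partial>D) \<le> 1"
        by (cases "H0 \<le> i \<and> b = a") (auto simp: D.emeasure_space_1)
    qed
    also have "\<dots> = 1" by (simp add: W.emeasure_space_1)
    finally show "(\<integral>\<^sup>+\<xi>. g i \<omega> \<xi> \<partial>N (Suc i)) \<le> 1" .
  qed
  also have "(\<integral>\<^sup>+\<omega>. (\<Prod>i<n. g i \<omega> (\<omega> (Suc i))) \<partial>P) = (\<integral>\<^sup>+\<omega>. ennreal (exp (l * (rew_sum a n \<omega> - real (cnt a n \<omega>) * r a) - real (cnt a n \<omega>) * (l\<^sup>2 / 8))) \<partial>P)"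
  proof (intro nn_integral_cong)
    fix \<omega>
    have "(\<Prod>i<n. g i \<omega> (\<omega> (Suc i))) = ennreal (exp (\<Sum>i<n. if H0 \<le> i \<and> act i \<omega> = a then c (fst (\<omega> (Suc i)) a) else 0))"
      unfolding g_def act_def by (simp add: prod_ennreal exp_sum)
    also have "(\<Sum>i<n. if H0 \<le> i \<and> act i \<omega> = a then c (fst (\<omega> (Suc i)) a) else 0)
       = (\<Sum>i\<in>{H0..<n}. if act i \<omega> = a then c (fst (\<omega> (Suc i)) a) else 0)"
      by (intro sum.mono_neutral_cong_right) auto
    also have "\<dots> = (\<Sum>i\<in>{i\<in>{H0..<n}. act i \<omega> = a}. c (fst (\<omega> (Suc i)) a))"
      by (rule sum.inter_filter[symmetric]) simp
    also have "\<dots> = l * (rew_sum a n \<omega> - real (cnt a n \<omega>) * r a) - real (cnt a n \<omega>) * (l\<^sup>2 / 8)"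
      unfolding c_def rew_sum_def cnt_def
      by (simp add: sum.inter_filter[symmetric] sum_subtractf right_diff_distrib flip: sum_distrib_left)
    finally show "(\<Prod>i<n. g i \<omega> (\<omega> (Suc i))) = ennreal (exp (l * (rew_sum a n \<omega> - real (cnt a n \<omega>) * r a) - real (cnt a n \<omega>) * (l\<^sup>2 / 8)))" .
  qed
  finally show ?thesis .
qed

text \<open>Fixing the number \<open>c\<close> of pulls makes the exponential rate deterministic; the union bound over
  \<open>c\<close> is affordable because each event has probability at most \<open>H ^ (-8)\<close>.\<close>

definition ucb_dev :: "nat \<times> nat \<times> nat \<times> real \<Rightarrow> (nat \<Rightarrow> noise) set" where
  "ucb_dev = (\<lambda>(a, n, c, s). {\<omega>\<in>space P. cnt a n \<omega> = c \<and>
     s * (rew_sum a n \<omega> - real c * r a) \<ge> 2 * sqrt (real c * L)})"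

definition bad_ucb :: "(nat \<Rightarrow> noise) set" where
  "bad_ucb = (\<Union>x\<in>{1..K} \<times> {..H} \<times> {1..H} \<times> {-1, 1}. ucb_dev x)"

lemma ucb_dev_sets [measurable]: "ucb_dev x \<in> sets P"
  unfolding ucb_dev_def by (cases x) (auto simp: split_beta')

lemma bad_ucb_sets [measurable]: "bad_ucb \<in> sets P"
  unfolding bad_ucb_def by (intro sets.finite_UN) auto

lemma prob_ucb_dev_le:
  assumes a: "a \<in> {1..K}" and c: "c \<ge> 1" and s: "s = -1 \<or> s = 1"
  shows "measure P (ucb_dev (a, n, c, s)) \<le> exp (- 8 * L)"
proof -
  \<comment> \<open>The maximiser of \<open>l * 2 * sqrt (c * L) - c * l\<^sup>2 / 8\<close> (for
    \<open>s = 1\<close>); its value is \<open>16 * L - 8 * L\<close>.\<close>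
  define l where "l = 8 * s * sqrt (L / real c)"
  have L0: "L \<ge> 0" using L_ge by simp
  have "measure P (ucb_dev (a, n, c, s)) \<le> exp (0 - 8 * L)"
  proof (rule P.P.prob_le_of_nn_integral_exp_le)
    show "(\<integral>\<^sup>+\<omega>. ennreal (exp (l * (rew_sum a n \<omega> - real (cnt a n \<omega>) * r a) - real (cnt a n \<omega>) * (l\<^sup>2 / 8))) \<partial>P) \<le> ennreal (exp 0)"
      using nn_integral_ucb_supermartingale[OF a] by simp
    fix \<omega> assume "\<omega> \<in> ucb_dev (a, n, c, s)"
    then have w: "cnt a n \<omega> = c" "s * (rew_sum a n \<omega> - real c * r a) \<ge> 2 * sqrt (real c * L)"
      by (auto simp: ucb_dev_def)
    have "l\<^sup>2 = 64 * (L / real c)" using s L0 by (auto simp: l_def power_mult_distrib)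
    then have l2: "real c * (l\<^sup>2 / 8) = 8 * L" using c by simp
    have "l * (rew_sum a n \<omega> - real c * r a) = 8 * sqrt (L / real c) * (s * (rew_sum a n \<omega> - real c * r a))"
      by (simp add: l_def)
    also have "\<dots> \<ge> 8 * sqrt (L / real c) * (2 * sqrt (real c * L))"
      using w(2) L0 by (intro mult_left_mono) auto
    finally have "l * (rew_sum a n \<omega> - real c * r a) \<ge> 16 * (sqrt (L / real c) * sqrt (real c * L))" by simp
    also have "sqrt (L / real c) * sqrt (real c * L) = L"
      using c L0 by (simp add: real_sqrt_mult[symmetric])
    finally show "8 * L \<le> l * (rew_sum a n \<omega> - real (cnt a n \<omega>) * r a) - real (cnt a n \<omega>) * (l\<^sup>2 / 8)"
      using l2 w(1) by simp
  qed simp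
  then show ?thesis by simp
qed

lemma prob_bad_ucb_le: "measure P bad_ucb \<le> real (K * (Suc H * (H * 2))) * exp (- 8 * L)"
proof -
  have "measure P bad_ucb \<le> (\<Sum>x\<in>{1..K} \<times> {..H} \<times> {1..H} \<times> {-1, 1}. measure P (ucb_dev x))"
    unfolding bad_ucb_def by (intro P.P.finite_measure_subadditive_finite) auto
  also have "\<dots> \<le> (\<Sum>x\<in>{1..K} \<times> {..H} \<times> {1..H} \<times> {-1, 1::real}. exp (- 8 * L))"
  proof (intro sum_mono)
    fix x :: "nat \<times> nat \<times> nat \<times> real" assume "x \<in> {1..K} \<times> {..H} \<times> {1..H} \<times> {-1, 1}"
    then obtain a n c s where "x = (a, n, c, s)" "a \<in> {1..K}" "c \<ge> 1" "s = -1 \<or> s = 1" by auto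
    then show "measure P (ucb_dev x) \<le> exp (- 8 * L)" using prob_ucb_dev_le by blast
  qed
  also have "\<dots> = real (K * (Suc H * (H * 2))) * exp (- 8 * L)"
    by (simp add: card_cartesian_product)
  finally show ?thesis .
qed

lemma cnt_le: "cnt a n \<omega> \<le> n"
proof -
  have "cnt a n \<omega> \<le> card {H0..<n}" unfolding cnt_def by (intro card_mono) auto
  then show ?thesis by simp
qed

lemma good_ucb:
  assumes "\<omega> \<in> space P" "\<omega> \<notin> bad_ucb" "a \<in> {1..K}" "n \<le> H" "cnt a n \<omega> > 0"
  shows "\<bar>rew_sum a n \<omega> / real (cnt a n \<omega>) - r a\<bar> \<le> 2 * sqrt (L / real (cnt a n \<omega>))"
proof -
  define c where "c = cnt a n \<omega>"
  have c: "c \<in> {1..H}" using assms(4,5) cnt_le[of a n \<omega>] by (auto simp: c_def)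
  have "\<omega> \<notin> ucb_dev (a, n, c, s)" if "s \<in> {-1, 1}" for s
    using assms(2-4) c that unfolding bad_ucb_def by blast
  from this[of 1] this[of "-1"] have *: "\<bar>rew_sum a n \<omega> - real c * r a\<bar> \<le> 2 * sqrt (real c * L)"
    using assms(1) by (auto simp: ucb_dev_def c_def[symmetric])
  have c0: "real c > 0" using c by simp
  have "rew_sum a n \<omega> / real c - r a = (rew_sum a n \<omega> - real c * r a) / real c"
    using c0 by (simp add: field_simps)
  then have "\<bar>rew_sum a n \<omega> / real c - r a\<bar> = \<bar>rew_sum a n \<omega> - real c * r a\<bar> / real c"
    using c0 by simp
  also have "\<dots> \<le> 2 * (sqrt (real c * L) / real c)" using * c0 by (simp add: field_simps)
  also have "sqrt (real c * L) / real c = sqrt (L / real c)"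
    using c0 by (simp add: real_sqrt_mult real_sqrt_divide field_simps)
  finally show ?thesis by (simp add: c_def)
qed

text \<open>Passes from the one-based times in \<open>ucb\<close> to the zero-based pull indices of
  \<open>cnt\<close> and \<open>rew_sum\<close>.\<close>

lemma ucb_eq:
  assumes n: "H0 \<le> n"
  shows "ucb K H (map snd (tr \<omega> n)) a = (if cnt a n \<omega> = 0 then 1
     else min 1 (rew_sum a n \<omega> / real (cnt a n \<omega>) + 2 * sqrt (L / real (cnt a n \<omega>))))"
proof -
  let ?os = "map snd (tr \<omega> n)"
  have fst_os: "fst (?os ! i) = act i \<omega>" "fst (snd (?os ! i)) = fst (\<omega> (Suc i)) (act i \<omega>)" if "i < n" for i
    using that by (simp_all add: traj_nth act_def next_entry_def split_beta Let_def)
  have "{i \<in> {H0 + 1..<n + 1}. fst (?os ! (i - 1)) = a} = Suc ` {i \<in> {H0..<n}. act i \<omega> = a}"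
  proof (intro set_eqI iffI)
    fix i assume "i \<in> {i \<in> {H0 + 1..<n + 1}. fst (?os ! (i - 1)) = a}"
    then have "i - 1 \<in> {i \<in> {H0..<n}. act i \<omega> = a}" "i = Suc (i - 1)" using fst_os(1)[of "i - 1"] by auto
    then show "i \<in> Suc ` {i \<in> {H0..<n}. act i \<omega> = a}" by blast
  qed (use fst_os in auto)
  then have c: "card {i \<in> {H0 + 1..<n + 1}. fst (?os ! (i - 1)) = a} = cnt a n \<omega>"
    by (simp add: cnt_def card_image)
  have "(\<Sum>i\<in>{H0 + 1..<n + 1}. if fst (?os ! (i - 1)) = a then fst (snd (?os ! (i - 1))) else 0)
      = (\<Sum>i\<in>{H0..<n}. if fst (?os ! i) = a then fst (snd (?os ! i)) else 0)"
    by (rule sum.reindex_bij_witness[of _ Suc "\<lambda>i. i - 1"]) auto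
  also have "\<dots> = rew_sum a n \<omega>"
    unfolding rew_sum_def using fst_os by (intro sum.cong) auto
  finally have s: "(\<Sum>i\<in>{H0 + 1..<n + 1}. if fst (?os ! (i - 1)) = a then fst (snd (?os ! (i - 1))) else 0) = rew_sum a n \<omega>" .
  have len: "length ?os = n" by simp
  show ?thesis
    unfolding ucb_def Let_def len c s by (auto simp: max_def)
qed

end

section \<open>Regret\<close>

lemma sum_sqrt_le:
  fixes x :: "nat \<Rightarrow> real"
  assumes "finite A" "\<And>a. a \<in> A \<Longrightarrow> 0 \<le> x a"
  shows "(\<Sum>a\<in>A. sqrt (x a)) \<le> sqrt (real (card A) * (\<Sum>a\<in>A. x a))"
proof (rule real_le_rsqrt)
  have "(\<Sum>a\<in>A. 1 * sqrt (x a))\<^sup>2 \<le> (\<Sum>a\<in>A. 1\<^sup>2) * (\<Sum>a\<in>A. (sqrt (x a))\<^sup>2)"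
    by (rule Cauchy_Schwarz_ineq_sum)
  also have "(\<Sum>a\<in>A. (sqrt (x a))\<^sup>2) = (\<Sum>a\<in>A. x a)" using assms by (intro sum.cong) auto
  finally show "(\<Sum>a\<in>A. sqrt (x a))\<^sup>2 \<le> real (card A) * (\<Sum>a\<in>A. x a)" by simp
qed

text \<open>Telescopes, since \<open>ln x \<le> x - 1\<close> bounds each term by a difference of
  logarithms.\<close>

lemma sum_inverse_le_ln: "(\<Sum>i<n. 1 / real (i + 2)) \<le> ln (real (n + 1))"
proof (induction n)
  case (Suc n)
  have "ln (real (n + 1) / real (n + 2)) \<le> real (n + 1) / real (n + 2) - 1"
    by (rule ln_le_minus_one) simp
  also have "\<dots> = - (1 / real (n + 2))" by (simp add: field_simps)
  finally have "1 / real (n + 2) \<le> ln (real (n + 2)) - ln (real (n + 1))"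
    by (simp add: ln_div)
  with Suc show ?case by (simp add: add_ac)
qed simp

context trust_bandit
begin

text \<open>\<open>pot\<close> is a potential: its increments dominate \<open>bonus\<close>, so summing the bonuses telescopes.\<close>

definition pot :: "nat \<Rightarrow> real" where
  "pot c = (if c = 0 then 0 else 1) + 16 * sqrt (L * real c)"

text \<open>Twice the confidence radius, which is how far a UCB value can exceed the true mean on
  the good event; a first pull is charged the maximal gap 1.\<close>

definition bonus :: "nat \<Rightarrow> real" where
  "bonus c = (if c = 0 then 1 else 4 * sqrt (L / real c))"

lemma L_nonneg: "L \<ge> 0" using L_ge by simp

text \<open>From \<open>(y - x) * (y + x) = 1\<close> and \<open>y \<le> 2 * x\<close> follows
  \<open>1 / x \<le> 3 * (y - x)\<close>, so \<open>4 / x\<close> is covered by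
  \<open>12 * (y - x)\<close>, within the 16 of \<open>pot\<close>.\<close>

lemma bonus_le_pot_diff: "bonus c \<le> pot (Suc c) - pot c"
proof (cases "c = 0")
  case True
  then show ?thesis using L_nonneg by (simp add: bonus_def pot_def)
next
  case False
  define x where "x = sqrt (real c)"
  define y where "y = sqrt (real (Suc c))"
  have x: "x \<ge> 1" using False by (simp add: x_def)
  have xy: "x \<le> y" by (simp add: x_def y_def)
  have y2: "y\<^sup>2 = x\<^sup>2 + 1" by (simp add: x_def y_def)
  have "1 \<le> x\<^sup>2" using x by (rule one_le_power)
  then have y4: "y\<^sup>2 \<le> (2 * x)\<^sup>2" using y2 by (simp only: power_mult_distrib) simp
  have y2x: "y \<le> 2 * x" by (rule power2_le_imp_le[OF y4]) (use x in simp)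
  have "1 = (y - x) * (y + x)" using y2 by (simp add: power2_eq_square algebra_simps)
  also have "\<dots> \<le> (y - x) * (3 * x)" using xy y2x by (intro mult_left_mono) auto
  finally have "1 / x \<le> 3 * (y - x)" using x by (simp add: field_simps)
  then have "sqrt L * (1 / x) \<le> sqrt L * (3 * (y - x))" using L_nonneg by (intro mult_left_mono) auto
  moreover have "0 \<le> sqrt L * (y - x)" using L_nonneg xy by simp
  moreover have "sqrt L * (3 * (y - x)) = 3 * (sqrt L * (y - x))" by simp
  ultimately have "4 * (sqrt L * (1 / x)) \<le> 16 * (sqrt L * (y - x))" by linarith
  then show ?thesis using False
    by (simp add: bonus_def pot_def real_sqrt_mult real_sqrt_divide x_def y_def right_diff_distrib)
qed

lemma cnt_Suc:
  assumes "H0 \<le> n"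
  shows "cnt a (Suc n) \<omega> = (if act n \<omega> = a then Suc (cnt a n \<omega>) else cnt a n \<omega>)"
proof -
  have "{i \<in> {H0..<Suc n}. act i \<omega> = a} = (if act n \<omega> = a then insert n {i \<in> {H0..<n}. act i \<omega> = a} else {i \<in> {H0..<n}. act i \<omega> = a})"
    using assms by (auto simp: less_Suc_eq)
  then show ?thesis by (simp add: cnt_def)
qed

lemma sum_bonus_le_pot:
  assumes "H0 \<le> n"
  shows "(\<Sum>i\<in>{H0..<n}. if act i \<omega> \<in> {1..K} then bonus (cnt (act i \<omega>) i \<omega>) else 0) \<le> (\<Sum>a=1..K. pot (cnt a n \<omega>))"
  using assms
proof (induction n rule: dec_induct)
  case base
  show ?case using L_nonneg by (auto intro!: sum_nonneg simp: pot_def)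
next
  case (step n)
  have "(\<Sum>a=1..K. pot (cnt a n \<omega>)) + (if act n \<omega> \<in> {1..K} then bonus (cnt (act n \<omega>) n \<omega>) else 0)
     = (\<Sum>a=1..K. pot (cnt a n \<omega>) + (if a = act n \<omega> then bonus (cnt a n \<omega>) else 0))"
    by (simp add: sum.distrib)
  also have "\<dots> \<le> (\<Sum>a=1..K. pot (cnt a (Suc n) \<omega>))"
    using bonus_le_pot_diff step.hyps by (intro sum_mono) (auto simp: cnt_Suc le_diff_eq add.commute)
  finally show ?case using step by simp
qed

lemma sum_cnt_le: "H0 \<le> n \<Longrightarrow> (\<Sum>a=1..K. real (cnt a n \<omega>)) \<le> real (n - H0)"
proof (induction n rule: dec_induct)
  case base
  show ?case by (simp add: cnt_def)
next
  case (step n)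
  have "(\<Sum>a=1..K. real (cnt a (Suc n) \<omega>)) = (\<Sum>a=1..K. real (cnt a n \<omega>) + (if a = act n \<omega> then 1 else 0))"
    using step.hyps by (intro sum.cong) (auto simp: cnt_Suc)
  also have "\<dots> \<le> (\<Sum>a=1..K. real (cnt a n \<omega>)) + 1" by (simp add: sum.distrib)
  also have "\<dots> \<le> real (Suc n - H0)" using step by (simp add: Suc_diff_le)
  finally show ?case .
qed

text \<open>By Cauchy-Schwarz over the arms, since the pull counts sum to at most \<open>H\<close>,
  the sum of their roots is at most \<open>sqrt (K * H)\<close>.\<close>

lemma sum_bonus_le:
  assumes "H0 \<le> H"
  shows "(\<Sum>i\<in>{H0..<H}. if act i \<omega> \<in> {1..K} then bonus (cnt (act i \<omega>) i \<omega>) else 0)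
     \<le> real K + 16 * sqrt (real K * real H * L)"
proof -
  have "(\<Sum>a=1..K. pot (cnt a H \<omega>)) \<le> (\<Sum>a=1..K. 1 + 16 * sqrt L * sqrt (real (cnt a H \<omega>)))"
    by (intro sum_mono) (auto simp: pot_def real_sqrt_mult)
  also have "\<dots> = real K + 16 * sqrt L * (\<Sum>a=1..K. sqrt (real (cnt a H \<omega>)))"
    by (simp add: sum.distrib sum_distrib_left)
  also have "\<dots> \<le> real K + 16 * sqrt L * sqrt (real (card {1..K}) * (\<Sum>a=1..K. real (cnt a H \<omega>)))"
    using L_nonneg by (intro add_left_mono mult_left_mono sum_sqrt_le) auto
  also have "\<dots> \<le> real K + 16 * sqrt L * sqrt (real K * real H)"
    using L_nonneg sum_cnt_le[OF assms, of \<omega>]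
    by (intro add_left_mono mult_left_mono real_sqrt_le_mono mult_mono) (auto intro!: sum_nonneg)
  also have "\<dots> = real K + 16 * sqrt (real K * real H * L)" by (simp add: real_sqrt_mult)
  finally show ?thesis using sum_bonus_le_pot[OF assms, of \<omega>] by linarith
qed

lemma opt_arm: obtains a where "a \<in> T" "r a = opt_mean D K"
  using inst by (auto simp: trust_aware_instance_def)

definition gap :: "nat \<Rightarrow> (nat \<Rightarrow> noise) \<Rightarrow> real" where
  "gap i \<omega> = opt_mean D K - r (act i \<omega>)"

lemma gap_le_1: "act i \<omega> \<in> {1..K} \<Longrightarrow> gap i \<omega> \<le> 1"
proof -
  assume a: "act i \<omega> \<in> {1..K}"
  obtain b where "b \<in> T" "r b = opt_mean D K" by (rule opt_arm)
  then show ?thesis using r_bounds[OF a] r_bounds[of b] T_sub by (auto simp: gap_def)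
qed

lemma gap_nonneg: "act i \<omega> \<in> {1..K} \<Longrightarrow> 0 \<le> gap i \<omega>"
  by (simp add: gap_def opt_mean_def)

lemma regret_eq: "regret K H T D \<omega> = (\<Sum>i<H. gap i \<omega>)"
proof -
  have "regret K H T D \<omega> = (\<Sum>i<H. opt_mean D K - r (fst (snd (tr \<omega> H ! i))))"
    unfolding regret_def by (rule sum.reindex_bij_witness[of _ Suc "\<lambda>h. h - 1"]) auto
  also have "\<dots> = (\<Sum>i<H. gap i \<omega>)" by (intro sum.cong) (auto simp: gap_def act_def traj_nth)
  finally show ?thesis .
qed

section \<open>Stage 2 on the good event\<close>

definition bad_trust :: "(nat \<Rightarrow> noise) set" where
  "bad_trust = (\<Union>k<K. bad_block k)"

lemma choice_in_T:
  assumes "\<omega> \<in> space P" "\<omega> \<notin> bad_trust" "H0 \<le> n"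
  shows "alg_choice K H (map snd (tr \<omega> n)) tb \<in> T"
    "b \<in> T \<Longrightarrow> ucb K H (map snd (tr \<omega> n)) b \<le> ucb K H (map snd (tr \<omega> n)) (alg_choice K H (map snd (tr \<omega> n)) tb)"
proof -
  have "trust_hat K H (map snd (tr \<omega> n)) K = T"
    using trust_hat_eq[OF assms(1) _ assms(3), of K] assms(2) T_sub by (auto simp: bad_trust_def)
  moreover have "T \<noteq> {}" using opt_arm by blast
  ultimately show "alg_choice K H (map snd (tr \<omega> n)) tb \<in> T"
    "b \<in> T \<Longrightarrow> ucb K H (map snd (tr \<omega> n)) b \<le> ucb K H (map snd (tr \<omega> n)) (alg_choice K H (map snd (tr \<omega> n)) tb)"
    using alg_choice_stage2[of K H "map snd (tr \<omega> n)"] assms(3) K2 by auto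
qed

text \<open>At worst every Stage 1 step recommended an untrusted arm, so distrust is at most
  \<open>1 + H0\<close>; afterwards it is frozen because every recommendation lies in
  \<open>T\<close>.\<close>

lemma trust_level_stage2:
  assumes "\<omega> \<in> space P" "\<omega> \<notin> bad_trust" "H0 \<le> n"
  shows "1 - real (1 + H0) / real (n + 2) \<le> trust_level T (tr \<omega> n)"
proof -
  from assms(3) have "1 + (n - H0) \<le> alpha_tr T (tr \<omega> n)"
  proof (induction n rule: dec_induct)
    case base
    show ?case by (simp add: alpha_tr_def)
  next
    case (step n)
    then show ?case
      using choice_in_T(1)[OF assms(1,2) step.hyps(1)]
      by (simp add: traj_append alpha_tr_snoc fst_next_entry Suc_diff_le)
  qed
  then have "real n + 1 - real H0 \<le> real (alpha_tr T (tr \<omega> n))" using assms(3) by linarith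
  then have "(real n + 1 - real H0) / real (n + 2) \<le> trust_level T (tr \<omega> n)"
    unfolding trust_level_eq length_traj by (intro divide_right_mono) auto
  moreover have "1 - real (1 + H0) / real (n + 2) = (real n + 1 - real H0) / real (n + 2)"
    by (simp add: field_simps)
  ultimately show ?thesis by simp
qed

text \<open>A late refusal of the recommendation forces the uniform draw above a deterministic level, so its
  probability needs no conditioning on the past.\<close>

definition defect :: "nat \<Rightarrow> (nat \<Rightarrow> noise) set" where
  "defect i = {\<omega>\<in>space P. \<omega> (Suc i) \<in> {\<xi>\<in>space (N (Suc i)). fst (snd \<xi>) \<in> {1 - real (1 + H0) / real (i + 2)..}}}"

text \<open>A refused recommendation is paid for by \<open>defect\<close>, with gap at most 1. A
  followed one obeys optimism: the optimal mean is below the UCB of an optimal arm, which is below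
  that of the chosen arm, which exceeds its mean by at most \<open>bonus\<close>.\<close>

lemma gap_stage2_le:
  assumes \<omega>: "\<omega> \<in> space P" and good: "\<omega> \<notin> bad_trust" "\<omega> \<notin> bad_ucb"
    and i: "H0 \<le> i" "i < H" and a: "act i \<omega> \<in> {1..K}"
  shows "gap i \<omega> \<le> indicator (defect i) \<omega> + (if act i \<omega> \<in> {1..K} then bonus (cnt (act i \<omega>) i \<omega>) else 0)"
proof (cases "chi i \<omega>")
  case False
  have "\<omega> (Suc i) \<in> space (N (Suc i))" using \<omega> by (auto simp: space_PiM)
  then have "\<omega> \<in> defect i"
    using False trust_level_stage2[OF \<omega> good(1) i(1)] \<omega> by (simp add: chi_def defect_def)
  moreover have "bonus (cnt (act i \<omega>) i \<omega>) \<ge> 0" using L_nonneg by (simp add: bonus_def)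
  ultimately show ?thesis using gap_le_1[OF a] a by simp
next
  case True
  define p where "p = act i \<omega>"
  let ?os = "map snd (tr \<omega> i)"
  have p: "p = alg_choice K H ?os (snd (snd (snd (\<omega> (Suc i)))))" using True by (simp add: act_eq p_def)
  have pK: "p \<in> {1..K}" using a by (simp add: p_def)
  obtain b where b: "b \<in> T" "r b = opt_mean D K" by (rule opt_arm)
  have bK: "b \<in> {1..K}" using b T_sub by auto
  \<comment> \<open>The optimal arm \<open>b\<close> competes in the argmax because it lies in
    \<open>T\<close>, which equals the estimated set here.\<close>
  have le: "ucb K H ?os b \<le> ucb K H ?os p" unfolding p by (rule choice_in_T(2)[OF \<omega> good(1) i(1) b(1)])
  have "r b \<le> ucb K H ?os b"
    using good_ucb[OF \<omega> good(2) bK, of i] i r_bounds[OF bK] by (auto simp: ucb_eq[OF i(1)] abs_le_iff)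
  with le have rp: "r b \<le> ucb K H ?os p" by simp
  have "gap i \<omega> \<le> bonus (cnt p i \<omega>)"
  proof (cases "cnt p i \<omega> = 0")
    case True
    then show ?thesis using gap_le_1[OF a] by (simp add: bonus_def)
  next
    case False
    then have "ucb K H ?os p \<le> r p + 4 * sqrt (L / real (cnt p i \<omega>))"
      using good_ucb[OF \<omega> good(2) pK, of i] i by (auto simp: ucb_eq[OF i(1)] abs_le_iff min_def)
    with rp False show ?thesis by (simp add: gap_def bonus_def b(2) p_def)
  qed
  then show ?thesis using pK by (simp add: p_def[symmetric] add_increasing)
qed

lemma act_range_AE: "AE \<omega> in P. \<forall>i. act i \<omega> \<in> {1..K}"
  using AE_own by eventually_elim (use alg_choice_range in \<open>auto simp: act_eq\<close>)

lemma regret_le_H: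
  assumes "\<forall>i. act i \<omega> \<in> {1..K}"
  shows "regret K H T D \<omega> \<le> real H"
proof -
  have "(\<Sum>i<H. gap i \<omega>) \<le> (\<Sum>i<H. 1)" using assms gap_le_1 by (intro sum_mono) auto
  then show ?thesis by (simp add: regret_eq)
qed

lemma regret_pointwise:
  assumes \<omega>: "\<omega> \<in> space P" and a: "\<forall>i. act i \<omega> \<in> {1..K}" and HH: "H0 \<le> H"
  shows "regret K H T D \<omega> \<le> real H0 + (real K + 16 * sqrt (real K * real H * L))
     + real H * indicator bad_trust \<omega> + real H * indicator bad_ucb \<omega> + (\<Sum>i\<in>{H0..<H}. indicator (defect i) \<omega>)"
proof (cases "\<omega> \<in> bad_trust \<union> bad_ucb")
  case True
  have "0 \<le> sqrt (real K * real H * L)" "0 \<le> (\<Sum>i\<in>{H0..<H}. indicator (defect i) \<omega> :: real)"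
    using L_nonneg by (auto intro!: sum_nonneg)
  moreover have "real H \<le> real H * indicator bad_trust \<omega> + real H * indicator bad_ucb \<omega>"
    using True by (auto simp: indicator_def)
  ultimately show ?thesis using regret_le_H[OF a] by linarith
next
  case False
  have "{..<H} = {..<H0} \<union> {H0..<H}" using HH by auto
  then have "regret K H T D \<omega> = (\<Sum>i<H0. gap i \<omega>) + (\<Sum>i\<in>{H0..<H}. gap i \<omega>)"
    unfolding regret_eq by (simp add: sum.union_disjoint ivl_disj_int)
  also have "(\<Sum>i<H0. gap i \<omega>) \<le> (\<Sum>i<H0. 1)" using a gap_le_1 by (intro sum_mono) auto
  also have "(\<Sum>i\<in>{H0..<H}. gap i \<omega>) \<le> (\<Sum>i\<in>{H0..<H}. indicator (defect i) \<omega> + (if act i \<omega> \<in> {1..K} then bonus (cnt (act i \<omega>) i \<omega>) else 0))"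
    using False a by (intro sum_mono gap_stage2_le \<omega>) auto
  also have "\<dots> \<le> (\<Sum>i\<in>{H0..<H}. indicator (defect i) \<omega>) + (real K + 16 * sqrt (real K * real H * L))"
    unfolding sum.distrib by (intro add_left_mono sum_bonus_le HH)
  finally show ?thesis using False by simp
qed

lemma bad_trust_sets [measurable]: "bad_trust \<in> sets P"
  unfolding bad_trust_def by measurable

lemma defect_noise_sets: "{\<xi>\<in>space (N (Suc i)). fst (snd \<xi>) \<in> {1 - real (1 + H0) / real (i + 2)..}} \<in> sets (N (Suc i))"
  by measurable

lemma defect_sets [measurable]: "defect i \<in> sets P"
  unfolding defect_def using defect_noise_sets[of i]
  by (intro measurable_sets_Collect[OF measurable_component_singleton]) auto

lemma prob_defect:
  assumes "H0 \<le> i"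
  shows "measure P (defect i) = real (1 + H0) * (1 / real (i + 2))"
proof -
  have "measure P (defect i) = measure U {1 - real (1 + H0) / real (i + 2)..}"
    unfolding defect_def by (subst measure_P_component[OF defect_noise_sets]) (rule measure_N_uniform, simp)
  \<comment> \<open>From \<open>H0 \<le> i\<close> the level is nonnegative, so the uniform exceeds
    it with probability exactly one minus the level.\<close>
  also have "\<dots> = 1 - (1 - real (1 + H0) / real (i + 2))"
    using assms by (intro measure_U_less) (auto simp: field_simps)
  finally show ?thesis by simp
qed

lemma prob_bad_trust_le: "measure P bad_trust \<le> real K * exp (- (5/8) * L)"
proof -
  have "measure P bad_trust \<le> (\<Sum>k<K. measure P (bad_block k))"
    unfolding bad_trust_def by (intro P.P.finite_measure_subadditive_finite) auto
  also have "\<dots> \<le> (\<Sum>k<K. exp (- (5/8) * L))" using prob_bad_block_le by (intro sum_mono) auto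
  finally show ?thesis by simp
qed

section \<open>Taking expectations and collecting constants\<close>

lemma expected_regret_le:
  assumes "AE \<omega> in P. regret K H T D \<omega> \<le> f \<omega>" "integrable P f"
  shows "expected_regret K H T D own \<le> (\<integral>\<omega>. f \<omega> \<partial>P)"
proof -
  have [measurable]: "r \<in> count_space UNIV \<rightarrow>\<^sub>M borel" by simp
  have "(\<lambda>\<omega>. regret K H T D \<omega>) \<in> borel_measurable P"
    unfolding regret_eq gap_def by measurable
  moreover have "AE \<omega> in P. norm (regret K H T D \<omega>) \<le> real H"
    using act_range_AE
  proof eventually_elim
    case (elim \<omega>)
    then have "0 \<le> regret K H T D \<omega>" unfolding regret_eq using gap_nonneg by (intro sum_nonneg) auto
    with regret_le_H[OF elim] show ?case by simp
  qed
  ultimately have "integrable P (\<lambda>\<omega>. regret K H T D \<omega>)" by (rule P.P.integrable_const_bound[rotated])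
  then show ?thesis unfolding expected_regret_def noise_space_eq
    using assms by (intro integral_mono_AE)
qed

text \<open>Settles horizons that end within Stage 1.\<close>

lemma expected_regret_le_H: "expected_regret K H T D own \<le> real H"
proof -
  have "expected_regret K H T D own \<le> (\<integral>\<omega>. real H \<partial>P)"
    using act_range_AE regret_le_H by (intro expected_regret_le) (auto elim: eventually_mono)
  then show ?thesis by (simp add: P.P.prob_space)
qed

lemma expected_regret_decomp:
  assumes HH: "H0 \<le> H"
  shows "expected_regret K H T D own \<le> real H0 + (real K + 16 * sqrt (real K * real H * L))
     + real H * measure P bad_trust + real H * measure P bad_ucb + real (1 + H0) * ln (real (H + 1))"
proof -
  have "expected_regret K H T D own \<le> (\<integral>\<omega>. real H0 + (real K + 16 * sqrt (real K * real H * L))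
     + real H * indicator bad_trust \<omega> + real H * indicator bad_ucb \<omega> + (\<Sum>i\<in>{H0..<H}. indicator (defect i) \<omega>) \<partial>P)"
  proof (rule expected_regret_le)
    show "AE \<omega> in P. regret K H T D \<omega> \<le> real H0 + (real K + 16 * sqrt (real K * real H * L))
     + real H * indicator bad_trust \<omega> + real H * indicator bad_ucb \<omega> + (\<Sum>i\<in>{H0..<H}. indicator (defect i) \<omega>)"
      using act_range_AE AE_space by eventually_elim (rule regret_pointwise[OF _ _ HH])
  qed (auto simp: P.P.emeasure_eq_measure)
  also have "\<dots> = real H0 + (real K + 16 * sqrt (real K * real H * L))
     + real H * measure P bad_trust + real H * measure P bad_ucb + (\<Sum>i\<in>{H0..<H}. measure P (defect i))"
    by (simp add: P.P.emeasure_eq_measure P.P.prob_space)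
  also have "(\<Sum>i\<in>{H0..<H}. measure P (defect i)) = real (1 + H0) * (\<Sum>i\<in>{H0..<H}. 1 / real (i + 2))"
    by (simp add: prob_defect sum_distrib_left)
  also have "(\<Sum>i\<in>{H0..<H}. 1 / real (i + 2)) \<le> (\<Sum>i<H. 1 / real (i + 2))"
    by (intro sum_mono2) auto
  also have "\<dots> \<le> ln (real (H + 1))" by (rule sum_inverse_le_ln)
  finally show ?thesis by (simp add: mult_left_mono)
qed

lemma expected_regret_bound:
  "expected_regret K H T D own \<le> 20 * sqrt (real K * real H * L) + 300 * real K ^ 4 * L\<^sup>2"
proof -
  define Q where "Q = real K ^ 4"
  have K1: "real K \<ge> 1" using K2 by simp
  have KQ: "real K \<le> Q" unfolding Q_def using K1 self_le_power[of "real K" 4] by simp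
  have Q1: "Q \<ge> 1" using KQ K1 by simp
  have L1: "2/3 * L \<le> L\<^sup>2" using L_ge by (simp add: power2_eq_square mult_right_mono)
  have QL: "Q * L \<le> 3/2 * (Q * L\<^sup>2)" using mult_left_mono[OF L1, of Q] Q1 by simp
  have Q2: "Q \<le> 3/2 * (Q * L)" using mult_left_mono[OF L_ge, of Q] Q1 by simp
  have H0_eq: "real H0 = 2 * real m * real K" by (simp add: tam_H0_def)
  have "real m * real K \<le> (30 * real K ^ 3 * L + 1) * real K" using m_le by (intro mult_right_mono) auto
  also have "\<dots> = 30 * (Q * L) + real K" by (simp add: Q_def eval_nat_numeral algebra_simps)
  finally have H0_le: "real H0 \<le> 60 * (Q * L) + 2 * Q" using KQ H0_eq by simp
  have S0: "0 \<le> sqrt (real K * real H * L)" using L_nonneg by simp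
  have QL2: "300 * real K ^ 4 * L\<^sup>2 = 300 * (Q * L\<^sup>2)" by (simp add: Q_def)
  show ?thesis
  proof (cases "H0 \<le> H")
    case False
    then have "expected_regret K H T D own \<le> real H0" using expected_regret_le_H by simp
    also have "\<dots> \<le> 300 * (Q * L\<^sup>2)" using H0_le QL Q2 by linarith
    finally show ?thesis using S0 QL2 by linarith
  next
    case True
    have expL: "exp L = real H" using H2 by simp
    have "30 * real K ^ 3 * L * real K \<le> real m * real K" using m_ge by (intro mult_right_mono) auto
    also have "\<dots> \<le> real H" using True H0_eq by linarith
    finally have "30 * (Q * L) \<le> real H" by (simp add: Q_def eval_nat_numeral algebra_simps)
    then have QH: "Q \<le> real H" using Q2 Q1 by linarith
    have K4: "real K \<le> exp (L / 4)"
    proof (rule power_le_imp_le_base)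
      show "real K ^ Suc 3 \<le> exp (L / 4) ^ Suc 3"
        using QH expL by (simp add: Q_def flip: exp_of_nat_mult)
    qed simp
    \<comment> \<open>The square of \<open>K * exp (3/8 * L)\<close> is
      \<open>K * K * H powr (3/4)\<close>; one factor \<open>K\<close> is at most
      \<open>H powr (1/4)\<close>, leaving \<open>K * H\<close>, and \<open>L \<ge> 2/3\<close>
      supplies the missing logarithm.\<close>
    have b1: "real H * measure P bad_trust \<le> 2 * sqrt (real K * real H * L)"
    proof -
      have "real H * measure P bad_trust \<le> exp L * (real K * exp (- (5/8) * L))"
        using prob_bad_trust_le unfolding expL by (intro mult_left_mono) auto
      also have "\<dots> = real K * exp (3/8 * L)" by (simp flip: exp_add)
      also have "\<dots> \<le> sqrt (4 * (real K * real H * L))"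
      proof (rule real_le_rsqrt)
        have "(real K * exp (3/8 * L))\<^sup>2 = real K * (real K * exp (3/4 * L))"
          by (simp add: power2_eq_square flip: exp_add)
        also have "\<dots> \<le> real K * (exp (L / 4) * exp (3/4 * L))"
          using K4 by (intro mult_left_mono mult_right_mono) auto
        also have "exp (L / 4) * exp (3/4 * L) = real H" by (simp add: expL flip: exp_add)
        also have "real K * real H \<le> real K * real H * (3/2 * L)"
          using mult_left_mono[of 1 "3/2 * L" "real K * real H"] L_ge by simp
        also have "\<dots> \<le> 4 * (real K * real H * L)" using L_nonneg by simp
        finally show "(real K * exp (3/8 * L))\<^sup>2 \<le> 4 * (real K * real H * L)" .
      qed
      finally show ?thesis by (simp add: real_sqrt_mult)
    qed
    have b2: "real H * measure P bad_ucb \<le> 4 * real K"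
    proof -
      have H8: "exp (- 8 * L) = 1 / real H ^ 8"
        using expL exp_of_nat_mult[of 8 L] by (simp add: exp_minus field_simps)
      have "real H * measure P bad_ucb \<le> real H * (real (K * (Suc H * (H * 2))) * exp (- 8 * L))"
        using prob_bad_ucb_le by (intro mult_left_mono) auto
      also have "\<dots> = 2 * real K * (real H ^ 2 * real (Suc H)) / real H ^ 8"
        unfolding H8 by (simp add: power2_eq_square algebra_simps add_divide_distrib)
      also have "\<dots> \<le> 2 * real K * (real H ^ 2 * (2 * real H)) / real H ^ 8"
        using H2 by (intro divide_right_mono mult_left_mono) auto
      also have "\<dots> = 4 * real K * (real H ^ 3 / real H ^ 8)"
        by (simp add: eval_nat_numeral)
      also have "\<dots> \<le> 4 * real K * 1"
        using H2 power_increasing[of 3 8 "real H"] by (intro mult_left_mono) (auto simp: divide_le_eq_1)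
      finally show ?thesis by simp
    qed
    have b3: "real (1 + H0) * ln (real (H + 1)) \<le> (60 * (Q * L) + 3 * Q) * (2 * L)"
    proof (intro mult_mono)
      show "real (1 + H0) \<le> 60 * (Q * L) + 3 * Q" using H0_le Q1 by simp
      have "real (H + 1) \<le> real H ^ 2"
      proof -
        have "2 * real H \<le> real H * real H" using H2 by (intro mult_right_mono) auto
        moreover have "real H \<ge> 2" using H2 by simp
        ultimately show ?thesis unfolding power2_eq_square of_nat_add by linarith
      qed
      then have "ln (real (H + 1)) \<le> ln (real H ^ 2)" using H2 by (subst ln_le_cancel_iff) auto
      also have "\<dots> = 2 * L" using H2 by (simp add: ln_realpow)
      finally show "ln (real (H + 1)) \<le> 2 * L" .
    qed (use Q1 L_nonneg in auto)
    also have "\<dots> = 120 * (Q * L\<^sup>2) + 6 * (Q * L)" by (simp add: power2_eq_square algebra_simps)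
    \<comment> \<open>The root terms add up to 16 + 2. The rest is at most
      \<open>120 * Q * L\<^sup>2 + 66 * Q * L + 7 * Q\<close>, and \<open>Q2\<close> and
      \<open>QL\<close> convert the lower orders, giving less than
      \<open>235 * Q * L\<^sup>2\<close>.\<close>
    finally have "expected_regret K H T D own \<le> 18 * sqrt (real K * real H * L) + 300 * (Q * L\<^sup>2)"
      using expected_regret_decomp[OF True] b1 b2 H0_le QL Q2 KQ by linarith
    then show ?thesis using S0 QL2 by linarith
  qed
qed

end

theorem theorem2:
  shows "\<exists>C1 C2 :: real. C1 > 0 \<and> C2 > 0 \<and>
    (\<forall>K H D T own. K \<ge> 2 \<longrightarrow> H \<ge> 2 \<longrightarrow> trust_aware_instance K D T own \<longrightarrow>
       expected_regret K H T D own
         \<le> C1 * sqrt (real K * real H * ln (real H)) + C2 * real K ^ 4 * (ln (real H))^2)"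
proof (intro exI conjI allI impI)
  fix K H :: nat and D T own
  assume "K \<ge> 2" "H \<ge> 2" "trust_aware_instance K D T own"
  then interpret trust_bandit K H D T own by unfold_locales
  show "expected_regret K H T D own
         \<le> 20 * sqrt (real K * real H * ln (real H)) + 300 * real K ^ 4 * (ln (real H))^2"
    by (rule expected_regret_bound)
qed simp_all

end
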